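(* Let $I=(\{1,\ldots,n\},\preceq_I)$ be a finite connected poset and let $\mathcal H(I)$ be its Hasse digraph. (a) $I$ is non-negative with $\mathrm{crk}_I=0$ and $\mathrm{Dyn}_I=\mathbb A_n$ if and only if $\mathcal H(I)$ is an oriented path, i.e. the underlying undirected graph of $\mathcal H(I)$ is a path graph (the arrows may be oriented arbitrarily). (b) $I$ is non-negative with $\mathrm{crk}_I=1$ and $\mathrm{Dyn}_I=\mathbb A_{n-1}$ if and only if $\mathcal H(I)$ is $2$-regular (every vertex has degree $2$ in the underlying undirected graph) and $\mathcal H(I)$ has at least two sinks. (c) If $I$ is non-negative and $\mathrm{Dyn}_I=\mathbb A_{n-\mathrm{crk}_I}$, then $\mathrm{crk}_I\le 1$.
   Context: For a finite poset $I=(\{1,\dots,n\},\preceq_I)$: its incidence matrix is $C_I=[c_{ij}]\in M_n(\mathbb Z)$ with $c_{ij}=1$ if $i\preceq_I j$ and $c_{ij}=0$ otherwise; its symmetric Gram matrix is $G_I=\tfrac12(C_I+C_I^{tr})$ and its quadratic form is $q_I(v)=vG_Iv^{tr}$ for $v\in\mathbb Z^n$. $I$ is non-negative of corank $\mathrm{crk}_I=r$ if $G_I$ is positive semi-definite of rank $n-r$. The Hasse digraph $\mathcal H(I)$ has vertices $1,\dots,n$ and an arrow $i\to j$ iff $i\preceq_I j$, $i\ne j$, and there is no $k\notin\{i,j\}$ with $i\preceq_I k\preceq_I j$. $I$ is connected if the underlying undirected graph of $\mathcal H(I)$ is connected. A sink of a digraph is a vertex that is the tail of no arrow. Simply-laced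 Dynkin diagrams (as graphs): $\mathbb A_m$ ($m\ge1$) is the path on $m$ vertices; $\mathbb D_m$ ($m\ge4$) is a path on $m-1$ vertices with one extra vertex attached to the second vertex; $\mathbb E_6,\mathbb E_7,\mathbb E_8$ are the trees with one branching vertex and three arms having $1,2,2$, resp. $1,2,3$, resp. $1,2,4$ vertices. For a graph $\Gamma$ on $m$ vertices put $G_\Gamma=E_m-\tfrac12\mathrm{Adj}(\Gamma)$. Dynkin type: if $I$ is connected and non-negative of corank $r$, then $\mathrm{Ker}\,q_I=\{v\in\mathbb Z^n: q_I(v)=0\}$ is a free abelian group of rank $r$ and there are indices $k_1<\dots<k_r$ and a $\mathbb Z$-basis $h^{(1)},\dots,h^{(r)}$ of $\mathrm{Ker}\,q_I$ with $h^{(i)}_{k_j}=\delta_{ij}$; the subposet $I'=I\setminus\{k_1,\dots,k_r\}$ (with $I'=I$ if $r=0$) is connected and positive, and there is a unique $D\in\{\mathbb A_{n-r},\mathbb D_{n-r},\mathbb E_6,\mathbb E_7,\mathbb E_8\}$ on $n-r$ vertices with $G_{I'}=B^{tr}G_DB$ for some $B\in GL(n-r,\mathbb Z)$; $\mathrm{Dyn}_I:=D$ (this is independent of the choices). *)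

theory Defs
  imports "Jordan_Normal_Form.DL_Rank"
begin

text \<open>A finite poset I = ({1,...,n}, leq). Only the values of leq on {1..n} matter.
  Matrices are Jordan_Normal_Form matrices with 0-based indices: row/column i
  corresponds to the poset element i+1.\<close>

definition is_poset :: "nat \<Rightarrow> (nat \<Rightarrow> nat \<Rightarrow> bool) \<Rightarrow> bool" where
  "is_poset n leq \<longleftrightarrow>
     (\<forall>i\<in>{1..n}. leq i i) \<and>
     (\<forall>i\<in>{1..n}. \<forall>j\<in>{1..n}. leq i j \<and> leq j i \<longrightarrow> i = j) \<and>
     (\<forall>i\<in>{1..n}. \<forall>j\<in>{1..n}. \<forall>k\<in>{1..n}. leq i j \<and> leq j k \<longrightarrow> leq i k)"

definition incidence_mat :: "nat \<Rightarrow> (nat \<Rightarrow> nat \<Rightarrow> bool) \<Rightarrow> int mat" where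
  "incidence_mat n leq = mat n n (\<lambda>(i, j). if leq (Suc i) (Suc j) then 1 else 0)"

definition gram_mat :: "nat \<Rightarrow> (nat \<Rightarrow> nat \<Rightarrow> bool) \<Rightarrow> real mat" where
  "gram_mat n leq = (1/2) \<cdot>\<^sub>m (map_mat of_int (incidence_mat n leq)
                         + transpose_mat (map_mat of_int (incidence_mat n leq)))"

definition quad_form :: "nat \<Rightarrow> (nat \<Rightarrow> nat \<Rightarrow> bool) \<Rightarrow> int vec \<Rightarrow> real" where
  "quad_form n leq v = map_vec of_int v \<bullet> (gram_mat n leq *\<^sub>v map_vec of_int v)"

definition kernel_q :: "nat \<Rightarrow> (nat \<Rightarrow> nat \<Rightarrow> bool) \<Rightarrow> int vec set" where
  "kernel_q n leq = {v \<in> carrier_vec n. quad_form n leq v = 0}"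

definition pos_semidef :: "nat \<Rightarrow> real mat \<Rightarrow> bool" where
  "pos_semidef n A \<longleftrightarrow> (\<forall>x \<in> carrier_vec n. 0 \<le> x \<bullet> (A *\<^sub>v x))"

definition nonneg_crk :: "nat \<Rightarrow> (nat \<Rightarrow> nat \<Rightarrow> bool) \<Rightarrow> nat \<Rightarrow> bool" where
  "nonneg_crk n leq r \<longleftrightarrow> r \<le> n \<and> pos_semidef n (gram_mat n leq)
      \<and> vec_space.rank n (gram_mat n leq) = n - r"

definition hasse_arrow :: "nat \<Rightarrow> (nat \<Rightarrow> nat \<Rightarrow> bool) \<Rightarrow> nat \<Rightarrow> nat \<Rightarrow> bool" where
  "hasse_arrow n leq i j \<longleftrightarrow> i \<in> {1..n} \<and> j \<in> {1..n} \<and> leq i j \<and> i \<noteq> j \<and>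
      \<not> (\<exists>k\<in>{1..n}. k \<noteq> i \<and> k \<noteq> j \<and> leq i k \<and> leq k j)"

definition hasse_adj :: "nat \<Rightarrow> (nat \<Rightarrow> nat \<Rightarrow> bool) \<Rightarrow> nat \<Rightarrow> nat \<Rightarrow> bool" where
  "hasse_adj n leq i j \<longleftrightarrow> hasse_arrow n leq i j \<or> hasse_arrow n leq j i"

definition poset_connected :: "nat \<Rightarrow> (nat \<Rightarrow> nat \<Rightarrow> bool) \<Rightarrow> bool" where
  "poset_connected n leq \<longleftrightarrow> (\<forall>i\<in>{1..n}. \<forall>j\<in>{1..n}. (hasse_adj n leq)\<^sup>*\<^sup>* i j)"

definition hasse_oriented_path :: "nat \<Rightarrow> (nat \<Rightarrow> nat \<Rightarrow> bool) \<Rightarrow> bool" where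
  "hasse_oriented_path n leq \<longleftrightarrow> (\<exists>p. bij_betw p {0..<n} {1..n} \<and>
      (\<forall>a<n. \<forall>b<n. hasse_adj n leq (p a) (p b) \<longleftrightarrow> (a + 1 = b \<or> b + 1 = a)))"

definition hasse_2_regular :: "nat \<Rightarrow> (nat \<Rightarrow> nat \<Rightarrow> bool) \<Rightarrow> bool" where
  "hasse_2_regular n leq \<longleftrightarrow> (\<forall>i\<in>{1..n}. card {j\<in>{1..n}. hasse_adj n leq i j} = 2)"

definition hasse_sinks :: "nat \<Rightarrow> (nat \<Rightarrow> nat \<Rightarrow> bool) \<Rightarrow> nat set" where
  "hasse_sinks n leq = {i\<in>{1..n}. \<not> (\<exists>j. hasse_arrow n leq i j)}"

text \<open>G_{A_m} = E_m - 1/2 Adj(A_m), the path 0 - 1 - ... - (m-1).\<close>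
definition gram_A :: "nat \<Rightarrow> real mat" where
  "gram_A m = mat m m (\<lambda>(i, j). if i = j then 1 else if i + 1 = j \<or> j + 1 = i then - 1/2 else 0)"

text \<open>Dyn_I = A_m, following the definition: there are indices k_1 < ... < k_r in {1..n}
  and a Z-basis h^(1),...,h^(r) of Ker q_I with h^(i)_{k_j} = delta_ij, such that for the
  subposet I' = I \ {k_1,...,k_r} (elements relabelled 1..m increasingly) one has
  m = n - r and G_{I'} = B^tr G_{A_m} B for some B in GL(m, Z).\<close>
definition dyn_is_A :: "nat \<Rightarrow> (nat \<Rightarrow> nat \<Rightarrow> bool) \<Rightarrow> nat \<Rightarrow> bool" where
  "dyn_is_A n leq m \<longleftrightarrow> (\<exists>r k h B.
      strict_mono_on {1..r} k \<and> k ` {1..r} \<subseteq> {1..n} \<and>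
      (\<forall>i\<in>{1..r}. h i \<in> kernel_q n leq) \<and>
      (\<forall>i\<in>{1..r}. \<forall>j\<in>{1..r}. h i $ (k j - 1) = (if i = j then 1 else 0)) \<and>
      (\<forall>v\<in>kernel_q n leq. \<exists>c. \<forall>t<n. v $ t = (\<Sum>i\<in>{1..r}. c i * h i $ t)) \<and>
      (\<forall>c. (\<forall>t<n. (\<Sum>i\<in>{1..r}. c i * h i $ t) = 0) \<longrightarrow> (\<forall>i\<in>{1..r}. c i = (0::int))) \<and>
      m = n - r \<and>
      B \<in> carrier_mat m m \<and> invertible_mat B \<and>
      (let e = (\<lambda>a. sorted_list_of_set ({1..n} - k ` {1..r}) ! (a - 1)) in
        gram_mat m (\<lambda>a b. leq (e a) (e b))
          = transpose_mat (map_mat of_int B) * gram_A m * map_mat of_int B))"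

end

theory Submission
  imports Defs
begin

text \<open>If the type is \<open>A\<close>, reducing modulo the kernel of the form turns the elements of the poset into
  vectors of norm 2 in the root lattice, hence into roots \<open>e\<^sub>s - e\<^sub>t\<close>, with inner products 1 for
  comparable and 0 for incomparable pairs. So the comparability graph is a line graph, and in
  particular has no claw and no diamond. For a poset this forces Hasse degree at most 2: three
  neighbours of \<open>x\<close> in the Hasse digraph either form a claw at \<open>x\<close>, or two covers on one side and one on the other
  give a diamond. A connected graph of degree at most 2 is a path or a cycle, and a cycle with a single
  sink contains a diamond.

  Conversely, the elements of an oriented path are realised by an explicit \<open>\<int>\<close>-basis of the root
  lattice. In a cycle with at least two sinks the vector that is 1 on sinks and -1 on sources lies in
  the kernel, and removing a sink leaves an oriented path. So a path has corank 0 and a cycle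
  corank 1; as the corank is determined by the form, all three claims follow.\<close>

section \<open>Graphs of degree at most two\<close>

text \<open>The doubled form keeps everything integral: \<open>gram_A m\<close> is half the Gram
  matrix of the simple roots, so the elements become integer vectors with coordinate sum 0 whose
  inner products are the entries 2, 1, 0 of the doubled Gram matrix. Roots of type A can also have
  product -1, but a poset has no negative entries. Hence the head \<open>s\<close> of one root is
  never the tail \<open>t\<close> of another, and comparability is adjacency in the line graph of a
  bipartite graph, with heads on one side and tails on the other. Bipartiteness is what excludes
  diamonds: the line graph of a triangle with a pendant edge is itself a diamond, whereas in a
  bipartite graph two edges with exactly one common end have common neighbours only through that
  end. In the converse the difficulty is integrality, as the type asks for a matrix invertible over
  the integers. The roots chosen along a path therefore have a triangular coefficient matrix with
  entries 1 or -1 on the diagonal.\<close>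

lemma successively_nth:
  "successively P xs \<Longrightarrow> Suc i < length xs \<Longrightarrow> P (xs ! i) (xs ! Suc i)"
proof (induction P xs arbitrary: i rule: successively.induct)
  case (3 P x y xs)
  then show ?case by (cases i) auto
qed auto

locale degree_le_2_graph =
  fixes V :: "'a set" and adj :: "'a \<Rightarrow> 'a \<Rightarrow> bool"
  assumes fin: "finite V" and ne: "V \<noteq> {}"
    and inV: "adj x y \<Longrightarrow> y \<in> V"
    and sym: "adj x y \<Longrightarrow> adj y x"
    and irr: "\<not> adj x x"
    and deg: "adj x a \<Longrightarrow> adj x b \<Longrightarrow> adj x c \<Longrightarrow> a = b \<or> a = c \<or> b = c"
    and conn: "x \<in> V \<Longrightarrow> y \<in> V \<Longrightarrow> adj\<^sup>*\<^sup>* x y"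
begin

text \<open>A longest path is closed under adjacency: its ends cannot be extended, and an inner
  vertex already has its two neighbours on the path. Connectedness does the rest.\<close>

lemma longest_path_spans:
  shows "\<exists>xs. distinct xs \<and> set xs = V \<and> successively adj xs"
proof -
  let ?S = "{xs. distinct xs \<and> set xs \<subseteq> V \<and> successively adj xs}"
  obtain v where v: "v \<in> V" using ne by auto
  have vS: "[v] \<in> ?S" using v by simp
  have bnd: "\<forall>ys. ys \<in> ?S \<longrightarrow> length ys < Suc (card V)"
  proof (intro allI impI)
    fix ys assume "ys \<in> ?S"
    then show "length ys < Suc (card V)"
      using distinct_card[of ys] card_mono[OF fin, of "set ys"] by simp
  qed
  obtain xs where xs: "xs \<in> ?S" and mx: "\<And>ys. ys \<in> ?S \<Longrightarrow> length ys \<le> length xs"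
    using ex_has_greatest_nat[of "\<lambda>xs. xs \<in> ?S", OF vS bnd] by blast
  have xsne: "xs \<noteq> []" using mx[OF vS] by auto
  have closed: "y \<in> set xs" if x: "x \<in> set xs" and a: "adj x y" for x y
  proof (rule ccontr)
    assume y: "y \<notin> set xs"
    have yV: "y \<in> V" using inV a by blast
    obtain i where i: "i < length xs" "x = xs ! i" using x by (auto simp: in_set_conv_nth)
    consider "i = 0" | "Suc i = length xs" | "0 < i" "Suc i < length xs" using i by linarith
    then show False
    proof cases
      case 1
      then have "adj y (hd xs)" using a sym i xsne by (simp add: hd_conv_nth)
      then have "y # xs \<in> ?S" using xs y yV xsne by (simp add: successively_Cons)
      from mx[OF this] show False by simp
    next
      case 2
      then have "adj (last xs) y" using a i xsne by (metis last_conv_nth diff_Suc_1)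
      then have "xs @ [y] \<in> ?S" using xs y yV xsne by (simp add: successively_append_iff)
      from mx[OF this] show False by simp
    next
      case 3
      have 1: "adj x (xs ! Suc i)"
        using xs 3 i by (simp add: successively_nth)
      have "adj (xs ! (i - 1)) (xs ! Suc (i - 1))"
        using xs 3 i successively_nth[of adj xs "i - 1"] by simp
      then have 2: "adj x (xs ! (i - 1))" using sym 3 i by simp
      have "xs ! Suc i \<noteq> xs ! (i - 1)"
        using xs 3 i by (simp add: nth_eq_iff_index_eq)
      moreover have "xs ! Suc i \<noteq> y" "xs ! (i - 1) \<noteq> y" using y 3 i by (auto simp: in_set_conv_nth)
      ultimately show False using deg[OF 1 2 a] by blast
    qed
  qed
  obtain x0 where x0: "x0 \<in> set xs" using xsne by (cases xs) auto
  have "y \<in> set xs" if "y \<in> V" for y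
  proof -
    have "adj\<^sup>*\<^sup>* x0 y" using conn x0 xs that by blast
    then show ?thesis by (induction) (use x0 closed in blast)+
  qed
  then show ?thesis using xs by blast
qed

text \<open>A chord ending at an inner vertex of the path would be its third edge there, so the only
  possible chord joins the two ends.\<close>

lemma path_chord:
  assumes d: "distinct xs" and s: "successively adj xs"
    and ab: "a < b" "b < length xs" and e: "adj (xs ! a) (xs ! b)"
  shows "b = Suc a \<or> (a = 0 \<and> Suc b = length xs)"
proof (rule ccontr)
  assume n: "\<not> ?thesis"
  have nxt: "adj (xs ! i) (xs ! Suc i)" if "Suc i < length xs" for i
    using s that by (simp add: successively_nth)
  have prv: "adj (xs ! i) (xs ! (i - 1))" if "i < length xs" "0 < i" for i
    using nxt[of "i - 1"] sym that by simp
  show False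
  proof (cases "a = 0")
    case False
    have "xs ! (a - 1) = xs ! b \<or> xs ! (a - 1) = xs ! Suc a \<or> xs ! b = xs ! Suc a"
      using deg[OF prv[of a] e nxt[of a]] False ab by auto
    then show False using d n ab by (auto simp: nth_eq_iff_index_eq)
  next
    case True
    have "xs ! (b - 1) = xs ! a \<or> xs ! (b - 1) = xs ! Suc b \<or> xs ! a = xs ! Suc b"
      using deg[OF prv[of b] sym[OF e] nxt[of b]] True ab n by auto
    moreover have "0 < length xs" using ab by linarith
    ultimately show False using d n ab True by (auto simp: nth_eq_iff_index_eq)
  qed
qed

text \<open>Only the chord between the ends remains to be excluded. The guard in \<open>no\<close>
  is there because the ends of a path with two vertices are consecutive.\<close>

lemma consecutive_iff:
  assumes d: "distinct xs" and s: "successively adj xs"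
    and no: "3 \<le> length xs \<Longrightarrow> \<not> adj (hd xs) (last xs)"
    and a: "a < length xs" and b: "b < length xs"
  shows "adj (xs ! a) (xs ! b) \<longleftrightarrow> a + 1 = b \<or> b + 1 = a"
proof -
  have up: "adj (xs ! a) (xs ! b) \<longleftrightarrow> a + 1 = b" if "a < b" "b < length xs" for a b
  proof
    assume e: "adj (xs ! a) (xs ! b)"
    have "b = Suc a \<or> (a = 0 \<and> Suc b = length xs)"
      by (rule path_chord[OF d s that e])
    moreover have False if x: "a = 0" "Suc b = length xs" "b \<noteq> Suc a"
    proof -
      have "xs \<noteq> []" using \<open>b < length xs\<close> by auto
      moreover have "b = length xs - 1" using x by simp
      ultimately have "adj (hd xs) (last xs)" using e x by (simp add: hd_conv_nth last_conv_nth)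
      then show False using no x \<open>a < b\<close> by simp
    qed
    ultimately show "a + 1 = b" by auto
  next
    assume "a + 1 = b"
    then show "adj (xs ! a) (xs ! b)" using successively_nth[OF s, of a] that by simp
  qed
  have "adj (xs ! a) (xs ! b) \<longleftrightarrow> adj (xs ! b) (xs ! a)" using sym by blast
  then show ?thesis using up[of a b] up[of b a] irr[of "xs ! a"] a b
    by (cases a b rule: linorder_cases) auto
qed

text \<open>The alternatives differ in whether the ends of a spanning path are joined. If they are,
  each end gains a second neighbour, and inner vertices have two anyway.\<close>

lemma path_or_cycle:
  shows "(\<exists>xs. distinct xs \<and> set xs = V \<and>
            (\<forall>a<length xs. \<forall>b<length xs. adj (xs ! a) (xs ! b) \<longleftrightarrow> a + 1 = b \<or> b + 1 = a))
    \<or> (\<forall>x\<in>V. \<exists>a b. a \<noteq> b \<and> adj x a \<and> adj x b)"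
proof -
  obtain xs where d: "distinct xs" and V: "set xs = V" and s: "successively adj xs"
    using longest_path_spans by blast
  show ?thesis
  proof (cases "3 \<le> length xs \<and> adj (hd xs) (last xs)")
    case False
    then have "\<forall>a<length xs. \<forall>b<length xs. adj (xs ! a) (xs ! b) \<longleftrightarrow> a + 1 = b \<or> b + 1 = a"
      using consecutive_iff[OF d s] by blast
    then show ?thesis using d V by blast
  next
    case True
    have nxt: "adj (xs ! i) (xs ! Suc i)" if "Suc i < length xs" for i
      using s that by (simp add: successively_nth)
    have cl: "adj (xs ! 0) (xs ! (length xs - 1))"
      using True hd_conv_nth[of xs] last_conv_nth[of xs] V ne by (cases "xs = []") auto
    have "\<exists>a b. a \<noteq> b \<and> adj x a \<and> adj x b" if xV: "x \<in> V" for x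
    proof -
      obtain i where i: "i < length xs" "x = xs ! i" using xV V by (metis in_set_conv_nth)
      consider "i = 0" | "Suc i = length xs" | "0 < i" "Suc i < length xs" using i by linarith
      then show ?thesis
      proof cases
        case 1
        then have "adj x (xs ! 1)" "adj x (xs ! (length xs - 1))" using nxt[of 0] True cl i by auto
        moreover have "xs ! 1 \<noteq> xs ! (length xs - 1)" using d True by (auto simp: nth_eq_iff_index_eq)
        ultimately show ?thesis by blast
      next
        case 2
        then have "adj x (xs ! (i - 1))" "adj x (xs ! 0)"
          using nxt[of "i - 1"] True sym[OF cl] i sym[of "xs ! (i - 1)" x] 2[symmetric] by auto
        moreover have "0 < length xs" using i by linarith
        then have "xs ! (i - 1) \<noteq> xs ! 0"
          using True 2 i nth_eq_iff_index_eq[OF d, of "i - 1" 0] by auto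
        ultimately show ?thesis by blast
      next
        case 3
        then have "adj x (xs ! (i - 1))" "adj x (xs ! Suc i)"
          using nxt[of "i - 1"] nxt[of i] i sym[of "xs ! (i - 1)" x] by auto
        moreover have "xs ! (i - 1) \<noteq> xs ! Suc i"
          using d 3 i by (auto simp: nth_eq_iff_index_eq)
        ultimately show ?thesis by blast
      qed
    qed
    then show ?thesis by blast
  qed
qed

text \<open>The first vertex of a spanning path has a second neighbour, which
  \<open>path_chord\<close> places at the other end. So the path closes up and can be cut open at
  \<open>k\<close> instead, which leaves \<open>zs @ ys\<close>.\<close>

lemma cycle_minus_vertex:
  assumes k: "k \<in> V"
    and two: "\<And>x. x \<in> V \<Longrightarrow> \<exists>a b. a \<noteq> b \<and> adj x a \<and> adj x b"
  shows "\<exists>xs. distinct xs \<and> set xs = V - {k} \<and>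
            (\<forall>a<length xs. \<forall>b<length xs. adj (xs ! a) (xs ! b) \<longleftrightarrow> a + 1 = b \<or> b + 1 = a)"
proof -
  obtain xs where d: "distinct xs" and V: "set xs = V" and s: "successively adj xs"
    using longest_path_spans by blast
  have xne: "xs \<noteq> []" using ne V by auto
  have cl: "adj (hd xs) (last xs)"
  proof -
    obtain u v where uv: "u \<noteq> v" "adj (hd xs) u" "adj (hd xs) v"
      using two V xne by (metis hd_in_set)
    then obtain w where w: "adj (xs ! 0) w" "w \<noteq> xs ! 1" using xne by (metis hd_conv_nth)
    then obtain i where i: "i < length xs" "w = xs ! i" using inV V by (metis in_set_conv_nth)
    have "i \<noteq> 0" using w i irr by metis
    then have "i = Suc 0 \<or> Suc i = length xs"
      using path_chord[OF d s, of 0 i] w i by auto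
    then have "i = length xs - 1" using w i by auto
    then show ?thesis using w i xne by (simp add: hd_conv_nth last_conv_nth)
  qed
  obtain ys zs where xs: "xs = ys @ k # zs" using k V by (metis split_list)
  define l where l: "l = zs @ ys"
  have dl: "distinct l" using d unfolding xs l by auto
  have kl: "k \<notin> set l" using d unfolding xs l by auto
  have sl: "successively adj l"
    using s cl unfolding xs l by (auto simp: successively_append_iff successively_Cons intro: sym)
  have lne: "l \<noteq> []" using cl irr unfolding xs l by auto
  have kh: "adj k (hd l)"
    using s cl lne unfolding xs l by (cases zs) (auto simp: successively_append_iff successively_Cons intro: sym)
  \<comment> \<open>The vertex \<open>hd l\<close> already has the neighbours \<open>k\<close> and
    \<open>l ! 1\<close>.\<close>
  have no: "\<not> adj (hd l) (last l)" if l3: "3 \<le> length l"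
  proof
    assume e: "adj (hd l) (last l)"
    have "adj (hd l) (l ! 1)" using successively_nth[OF sl, of 0] l3 lne by (simp add: hd_conv_nth)
    from deg[OF e this sym[OF kh]] have "last l = l ! 1 \<or> last l = k \<or> l ! 1 = k" .
    moreover have "last l \<in> set l" "l ! 1 \<in> set l" using lne l3 by auto
    ultimately have "l ! (length l - 1) = l ! 1" using kl last_conv_nth[OF lne] by metis
    then show False using nth_eq_iff_index_eq[OF dl, of "length l - 1" 1] l3 by linarith
  qed
  have "\<forall>a<length l. \<forall>b<length l. adj (l ! a) (l ! b) \<longleftrightarrow> a + 1 = b \<or> b + 1 = a"
    using consecutive_iff[OF dl sl no] by blast
  moreover have "set l = V - {k}" using d V unfolding xs l by auto
  ultimately show ?thesis using dl by blast
qed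

end

section \<open>Hasse digraphs\<close>

locale fin_poset =
  fixes n :: nat and leq :: "nat \<Rightarrow> nat \<Rightarrow> bool"
  assumes poset: "is_poset n leq"
begin

abbreviation V :: "nat set" where "V \<equiv> {1..n}"
abbreviation arr :: "nat \<Rightarrow> nat \<Rightarrow> bool" where "arr \<equiv> hasse_arrow n leq"
abbreviation adj :: "nat \<Rightarrow> nat \<Rightarrow> bool" where "adj \<equiv> hasse_adj n leq"
abbreviation cmp :: "nat \<Rightarrow> nat \<Rightarrow> bool" where "cmp i j \<equiv> leq i j \<or> leq j i"

lemma refl: "i \<in> V \<Longrightarrow> leq i i"
  and antisym: "i \<in> V \<Longrightarrow> j \<in> V \<Longrightarrow> leq i j \<Longrightarrow> leq j i \<Longrightarrow> i = j"
  and trans: "i \<in> V \<Longrightarrow> j \<in> V \<Longrightarrow> k \<in> V \<Longrightarrow> leq i j \<Longrightarrow> leq j k \<Longrightarrow> leq i k"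
  using poset unfolding is_poset_def by blast+

lemma arrD: "arr i j \<Longrightarrow> i \<in> V" "arr i j \<Longrightarrow> j \<in> V" "arr i j \<Longrightarrow> leq i j" "arr i j \<Longrightarrow> i \<noteq> j"
  unfolding hasse_arrow_def by auto

lemma arr_no_between: "arr i j \<Longrightarrow> k \<in> V \<Longrightarrow> leq i k \<Longrightarrow> leq k j \<Longrightarrow> k = i \<or> k = j"
  unfolding hasse_arrow_def by auto

lemma adj_sym: "adj i j \<Longrightarrow> adj j i"
  unfolding hasse_adj_def by auto

lemma adjD: "adj i j \<Longrightarrow> i \<in> V" "adj i j \<Longrightarrow> j \<in> V" "adj i j \<Longrightarrow> cmp i j" "adj i j \<Longrightarrow> i \<noteq> j"
  unfolding hasse_adj_def using arrD by blast+

lemma arr_rtrancl_leq: "arr\<^sup>*\<^sup>* i j \<Longrightarrow> i \<in> V \<Longrightarrow> j \<in> V \<and> leq i j"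
  by (induction rule: rtranclp_induct) (auto dest: arrD intro: refl trans)

text \<open>Induction on the size of the interval between \<open>i\<close> and \<open>j\<close>,
  which an intermediate element splits into two strictly smaller ones.\<close>

lemma leq_arr_rtrancl: "i \<in> V \<Longrightarrow> j \<in> V \<Longrightarrow> leq i j \<Longrightarrow> arr\<^sup>*\<^sup>* i j"
proof (induction "card {k \<in> V. leq i k \<and> leq k j}" arbitrary: i j rule: less_induct)
  case less
  show ?case
  proof (cases "i = j \<or> arr i j")
    case True
    then show ?thesis by auto
  next
    case False
    then obtain k where k: "k \<in> V" "k \<noteq> i" "k \<noteq> j" "leq i k" "leq k j"
      using less.prems unfolding hasse_arrow_def by auto
    have "{l \<in> V. leq i l \<and> leq l k} \<subset> {l \<in> V. leq i l \<and> leq l j}"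
    proof (rule psubsetI)
      show "{l \<in> V. leq i l \<and> leq l k} \<subseteq> {l \<in> V. leq i l \<and> leq l j}"
        using trans k less.prems by blast
      have "j \<notin> {l \<in> V. leq i l \<and> leq l k}" using antisym k less.prems by blast
      moreover have "j \<in> {l \<in> V. leq i l \<and> leq l j}" using refl less.prems by blast
      ultimately show "{l \<in> V. leq i l \<and> leq l k} \<noteq> {l \<in> V. leq i l \<and> leq l j}" by blast
    qed
    then have 1: "arr\<^sup>*\<^sup>* i k"
      by (intro less.hyps psubset_card_mono) (use k less.prems in auto)
    have "{l \<in> V. leq k l \<and> leq l j} \<subset> {l \<in> V. leq i l \<and> leq l j}"
    proof (rule psubsetI)
      show "{l \<in> V. leq k l \<and> leq l j} \<subseteq> {l \<in> V. leq i l \<and> leq l j}"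
        using trans k less.prems by blast
      have "i \<notin> {l \<in> V. leq k l \<and> leq l j}" using antisym k less.prems by blast
      moreover have "i \<in> {l \<in> V. leq i l \<and> leq l j}" using refl less.prems by blast
      ultimately show "{l \<in> V. leq k l \<and> leq l j} \<noteq> {l \<in> V. leq i l \<and> leq l j}" by blast
    qed
    then have 2: "arr\<^sup>*\<^sup>* k j"
      by (intro less.hyps psubset_card_mono) (use k less.prems in auto)
    show ?thesis using 1 2 by (rule rtranclp_trans)
  qed
qed

lemma upper_cover:
  assumes "i \<in> V" "j \<in> V" "leq i j" "i \<noteq> j"
  shows "\<exists>k. arr i k \<and> leq k j"
proof -
  obtain k where "arr i k" "arr\<^sup>*\<^sup>* k j"
    using leq_arr_rtrancl[OF assms(1-3)] assms(4) by (metis converse_rtranclpE)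
  then show ?thesis using arr_rtrancl_leq arrD by blast
qed

lemma lower_cover:
  assumes "i \<in> V" "j \<in> V" "leq i j" "i \<noteq> j"
  shows "\<exists>k. arr k j \<and> leq i k"
proof -
  obtain k where "arr k j" "arr\<^sup>*\<^sup>* i k"
    using leq_arr_rtrancl[OF assms(1-3)] assms(4) by (metis rtranclp.cases)
  then show ?thesis using arr_rtrancl_leq assms by blast
qed

lemma upper_covers_incomparable: "arr x y \<Longrightarrow> arr x y' \<Longrightarrow> y \<noteq> y' \<Longrightarrow> \<not> cmp y y'"
  using arr_no_between arrD by metis

lemma lower_covers_incomparable: "arr y x \<Longrightarrow> arr y' x \<Longrightarrow> y \<noteq> y' \<Longrightarrow> \<not> cmp y y'"
  using arr_no_between arrD by metis

lemma sink_above: "x \<in> V \<Longrightarrow> \<exists>M \<in> hasse_sinks n leq. leq x M"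
proof (induction "card {k \<in> V. leq x k}" arbitrary: x rule: less_induct)
  case less
  show ?case
  proof (cases "x \<in> hasse_sinks n leq")
    case True
    then show ?thesis using refl less.prems by blast
  next
    case False
    then obtain y where y: "arr x y" using less.prems unfolding hasse_sinks_def by auto
    note yD = arrD[OF y]
    have "{k \<in> V. leq y k} \<subseteq> {k \<in> V. leq x k}" using trans yD by blast
    moreover have "x \<notin> {k \<in> V. leq y k}" "x \<in> {k \<in> V. leq x k}" using antisym refl yD by blast+
    ultimately have "{k \<in> V. leq y k} \<subset> {k \<in> V. leq x k}" by blast
    then have "card {k \<in> V. leq y k} < card {k \<in> V. leq x k}" by (intro psubset_card_mono) auto
    then obtain M where "M \<in> hasse_sinks n leq" "leq y M" using less.hyps yD by blast
    then show ?thesis using trans yD unfolding hasse_sinks_def by blast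
  qed
qed

lemma sink_maximal: "M \<in> hasse_sinks n leq \<Longrightarrow> x \<in> V \<Longrightarrow> leq M x \<Longrightarrow> x = M"
  using upper_cover unfolding hasse_sinks_def by blast

text \<open>Reversing the order swaps sinks with sources and preserves \<open>adj\<close>. With
  \<open>sources\<close> taken as the sinks of the reversed order, facts about sinks
  transfer.\<close>

lemma dual: "fin_poset n (\<lambda>i j. leq j i)"
  using poset unfolding is_poset_def fin_poset_def by blast

lemma arr_dual [simp]: "hasse_arrow n (\<lambda>i j. leq j i) i j = arr j i"
  unfolding hasse_arrow_def by blast

lemma adj_dual [simp]: "hasse_adj n (\<lambda>i j. leq j i) = adj"
  unfolding hasse_adj_def by auto

abbreviation sinks :: "nat set" where "sinks \<equiv> hasse_sinks n leq"
abbreviation sources :: "nat set" where "sources \<equiv> hasse_sinks n (\<lambda>i j. leq j i)"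

lemma sinks_iff: "x \<in> sinks \<longleftrightarrow> x \<in> V \<and> (\<forall>y. \<not> arr x y)"
  unfolding hasse_sinks_def by auto

lemma sources_iff: "x \<in> sources \<longleftrightarrow> x \<in> V \<and> (\<forall>y. \<not> arr y x)"
  unfolding hasse_sinks_def by auto

lemmas source_below = fin_poset.sink_above[OF dual]
lemmas source_minimal = fin_poset.sink_maximal[OF dual]

section \<open>Diamonds and claws in the comparability graph\<close>

definition diamond_free :: bool where
  "diamond_free \<longleftrightarrow> (\<forall>x\<in>V. \<forall>z\<in>V. \<forall>y\<in>V. \<forall>w\<in>V. x \<noteq> z \<and> cmp x z \<and>
     y \<noteq> x \<and> y \<noteq> z \<and> cmp x y \<and> cmp z y \<and> w \<noteq> x \<and> w \<noteq> z \<and> cmp x w \<and> cmp z w \<longrightarrow> cmp y w)"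

text \<open>The leaves need not be distinct, just as \<open>y\<close> and \<open>w\<close> in
  \<open>diamond_free\<close>: a coincidence makes the conclusion true by reflexivity, so exactly
  the induced configurations are forbidden.\<close>

definition claw_free :: bool where
  "claw_free \<longleftrightarrow> (\<forall>x\<in>V. \<forall>y\<in>V. \<forall>z\<in>V. \<forall>w\<in>V. x \<noteq> y \<and> x \<noteq> z \<and> x \<noteq> w \<and>
     cmp x y \<and> cmp x z \<and> cmp x w \<longrightarrow> cmp y z \<or> cmp y w \<or> cmp z w)"

lemma diamond_freeD:
  assumes diamond_free "x \<in> V" "z \<in> V" "y \<in> V" "w \<in> V" "x \<noteq> z" "cmp x z"
    "y \<noteq> x" "y \<noteq> z" "cmp x y" "cmp z y" "w \<noteq> x" "w \<noteq> z" "cmp x w" "cmp z w"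
  shows "cmp y w"
  using assms unfolding diamond_free_def by blast

lemma claw_freeD:
  assumes claw_free "x \<in> V" "y \<in> V" "z \<in> V" "w \<in> V" "x \<noteq> y" "x \<noteq> z" "x \<noteq> w"
    "cmp x y" "cmp x z" "cmp x w"
  shows "cmp y z \<or> cmp y w \<or> cmp z w"
  using assms unfolding claw_free_def by blast

text \<open>The middle edge of the diamond joins \<open>c\<close> and \<open>x\<close>: the covers
  \<open>a\<close> and \<open>b\<close> of \<open>x\<close> also lie above \<open>c\<close>, but two
  covers on the same side are incomparable.\<close>

lemma two_up_one_down:
  assumes diamond_free "arr x a" "arr x b" "arr c x" "a \<noteq> b"
  shows False
proof -
  note D = arrD[OF assms(2)] arrD[OF assms(3)] arrD[OF assms(4)]
  have "cmp c a" "cmp c b" using D trans by blast+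
  moreover have "a \<noteq> c" "b \<noteq> c" using D antisym by blast+
  ultimately have "cmp a b" using diamond_freeD[OF assms(1), of x c a b] D by blast
  then show False using upper_covers_incomparable assms by blast
qed

lemma one_up_two_down:
  assumes diamond_free "arr a x" "arr b x" "arr x c" "a \<noteq> b"
  shows False
proof -
  note D = arrD[OF assms(2)] arrD[OF assms(3)] arrD[OF assms(4)]
  have "cmp c a" "cmp c b" using D trans by blast+
  moreover have "a \<noteq> c" "b \<noteq> c" using D antisym by blast+
  ultimately have "cmp a b" using diamond_freeD[OF assms(1), of x c a b] D by blast
  then show False using lower_covers_incomparable assms by blast
qed

lemma hasse_degree_le_2:
  assumes d: diamond_free and c: claw_free and a: "adj x a" "adj x b" "adj x c"
  shows "a = b \<or> a = c \<or> b = c"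
proof (rule ccontr)
  assume n: "\<not> ?thesis"
  have "cmp a b \<or> cmp a c \<or> cmp b c"
    using claw_freeD[OF c, of x a b c] adjD[OF a(1)] adjD[OF a(2)] adjD[OF a(3)] by blast
  moreover have "arr x a \<or> arr a x" "arr x b \<or> arr b x" "arr x c \<or> arr c x"
    using a unfolding hasse_adj_def by auto
  ultimately show False
    using two_up_one_down[OF d] one_up_two_down[OF d] n
      upper_covers_incomparable lower_covers_incomparable by metis
qed

text \<open>A single sink \<open>M\<close> would be a greatest element. The two neighbours of a
  source \<open>z\<close> are incomparable and lie between \<open>z\<close> and \<open>M\<close>,
  which gives a diamond with middle edge from \<open>z\<close> to \<open>M\<close>.\<close>

lemma two_sinks:
  assumes d: diamond_free and n: "1 \<le> n"
    and two: "\<And>x. x \<in> V \<Longrightarrow> \<exists>a b. a \<noteq> b \<and> adj x a \<and> adj x b"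
  shows "2 \<le> card sinks"
proof (rule ccontr)
  assume c: "\<not> 2 \<le> card sinks"
  have fs: "finite sinks" unfolding hasse_sinks_def by simp
  have "1 \<in> V" using n by simp
  obtain M where M: "M \<in> sinks" using sink_above[OF \<open>1 \<in> V\<close>] by blast
  have "card sinks \<noteq> 0" using M fs by auto
  then have "card sinks = 1" using c by linarith
  then have sM: "sinks = {M}" using M by (metis card_1_singletonE singletonD)
  have top: "leq x M" if "x \<in> V" for x using sink_above[OF that] unfolding sM by simp
  have MV: "M \<in> V" using M sinks_iff by blast
  obtain z where z: "z \<in> sources" using source_below[OF \<open>1 \<in> V\<close>] by blast
  have zV: "z \<in> V" using z sources_iff by blast
  obtain a b where ab: "a \<noteq> b" "adj z a" "adj z b" using two[OF zV] by blast
  have ar: "arr z a" "arr z b" using ab z unfolding hasse_adj_def sources_iff by blast+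
  note D = arrD[OF ar(1)] arrD[OF ar(2)]
  have inc: "\<not> cmp a b" using upper_covers_incomparable ar ab by blast
  have "a \<noteq> M" "b \<noteq> M" using top D inc by blast+
  moreover have "z \<noteq> M" using ar M sinks_iff by blast
  ultimately have "cmp a b" using diamond_freeD[OF d, of M z a b] D MV top by blast
  then show False using inc by blast
qed

end

section \<open>Posets whose Hasse digraph is a cycle\<close>

locale hasse_cycle = fin_poset +
  assumes deg: "hasse_adj n leq x a \<Longrightarrow> hasse_adj n leq x b \<Longrightarrow> hasse_adj n leq x c \<Longrightarrow> a = b \<or> a = c \<or> b = c"
    and two: "x \<in> {1..n} \<Longrightarrow> \<exists>a b. a \<noteq> b \<and> hasse_adj n leq x a \<and> hasse_adj n leq x b"
    and conn: "x \<in> {1..n} \<Longrightarrow> y \<in> {1..n} \<Longrightarrow> (hasse_adj n leq)\<^sup>*\<^sup>* x y"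
begin

lemma dual_cycle: "hasse_cycle n (\<lambda>i j. leq j i)"
  using dual deg two conn unfolding hasse_cycle_def hasse_cycle_axioms_def adj_dual by blast

lemma arr_adj: "arr x y \<Longrightarrow> adj x y" "arr x y \<Longrightarrow> adj y x"
  unfolding hasse_adj_def by auto

text \<open>One of the two neighbours of a non-source lies below it, which leaves room for a single
  cover above.\<close>

lemma upper_cover_unique:
  assumes "arr x y" "arr x y'" "x \<notin> sources"
  shows "y = y'"
proof -
  obtain l where l: "arr l x" using assms arrD sources_iff by blast
  have "l \<noteq> y" "l \<noteq> y'" using arrD[OF l] arrD[OF assms(1)] arrD[OF assms(2)] antisym by blast+
  then show ?thesis using deg[of x l y y'] l assms arr_adj by blast
qed

text \<open>Upward walks from a non-source have no choice: the cover is unique, and every element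
  reached is again a non-source. Hence one walk continues the other.\<close>

lemma up_chain: "arr\<^sup>*\<^sup>* x a \<Longrightarrow> arr\<^sup>*\<^sup>* x b \<Longrightarrow> x \<in> V \<Longrightarrow> x \<notin> sources \<Longrightarrow> cmp a b"
proof (induction rule: converse_rtranclp_induct)
  case base
  then show ?case using arr_rtrancl_leq by blast
next
  case (step x y)
  show ?case
  proof (cases "x = b")
    case True
    then have "arr\<^sup>*\<^sup>* b a" using step by (meson converse_rtranclp_into_rtranclp)
    then show ?thesis using arr_rtrancl_leq step True by blast
  next
    case False
    then obtain y' where y': "arr x y'" "arr\<^sup>*\<^sup>* y' b" using step.prems by (metis converse_rtranclpE)
    have "y' = y" using upper_cover_unique y' step by blast
    moreover have "y \<notin> sources" using step.hyps sources_iff by blast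
    ultimately show ?thesis using step y' arrD by blast
  qed
qed

lemma above_comparable:
  "x \<in> V \<Longrightarrow> a \<in> V \<Longrightarrow> b \<in> V \<Longrightarrow> x \<notin> sources \<Longrightarrow> leq x a \<Longrightarrow> leq x b \<Longrightarrow> cmp a b"
  using up_chain leq_arr_rtrancl by blast

lemma unique_sink_above:
  assumes "x \<in> V" "x \<notin> sources"
  shows "card {M \<in> sinks. leq x M} = 1"
proof -
  obtain M where M: "M \<in> sinks" "leq x M" using sink_above assms by blast
  have "M' = M" if "M' \<in> sinks" "leq x M'" for M'
    using above_comparable[of x M M'] sink_maximal M that assms sinks_iff by metis
  then have "{M \<in> sinks. leq x M} = {M}" using M by blast
  then show ?thesis by simp
qed

text \<open>If both lower covers of the sink \<open>M\<close> lie over the same source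
  \<open>m\<close>, the interval from \<open>m\<close> to \<open>M\<close> contains both neighbours
  of each of its elements and is everything by connectedness. This excludes a common source as soon
  as there is another sink.\<close>

lemma interval_is_everything:
  assumes m: "m \<in> sources" and M: "M \<in> sinks"
    and y: "arr y M" "arr y' M" "y \<noteq> y'" and le: "leq m y" "leq m y'" and x: "x \<in> V"
  shows "leq m x \<and> leq x M"
proof -
  have mV: "m \<in> V" and MV: "M \<in> V" using m M sinks_iff sources_iff by blast+
  note yD = arrD[OF y(1)] arrD[OF y(2)]
  have inc: "\<not> cmp y y'" using lower_covers_incomparable y by blast
  have my: "m \<noteq> y" "m \<noteq> y'" using inc le by blast+
  have mM: "leq m M" using trans mV MV yD le by blast
  have closed: "leq m z \<and> leq z M" if x: "leq m x" "leq x M" and a: "adj x z" for x z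
  proof -
    note aD = adjD[OF a]
    consider "x = M" | "x = m" | "x \<noteq> m" "x \<noteq> M" by blast
    then show ?thesis
    proof cases
      case 1
      have "z = y \<or> z = y'" using deg[of M z y y'] a y arr_adj unfolding 1 by blast
      then show ?thesis using le yD by blast
    next
      case 2
      obtain u where u: "arr m u" "leq u y" using upper_cover my le yD mV by metis
      obtain u' where u': "arr m u'" "leq u' y'" using upper_cover my le yD mV by metis
      note uD = arrD[OF u(1)] arrD[OF u'(1)]
      \<comment> \<open>A common first step \<open>u\<close> would be a non-source with the
        incomparable elements \<open>y\<close> and \<open>y'\<close> above it.\<close>
      have "u \<noteq> u'"
      proof
        assume "u = u'"
        moreover have "u \<notin> sources" using u sources_iff by blast
        ultimately show False using above_comparable[of u y y'] u u' uD yD inc by blast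
      qed
      then have "z = u \<or> z = u'" using deg[of m z u u'] a u u' arr_adj unfolding 2 by blast
      moreover have "leq u M" "leq u' M" using trans u u' uD yD MV by blast+
      ultimately show ?thesis using uD by blast
    next
      case 3
      have ns: "x \<notin> sources" "x \<notin> sinks"
        using source_minimal sink_maximal 3 x mV MV by blast+
      from a consider "arr x z" | "arr z x" unfolding hasse_adj_def by blast
      then show ?thesis
      proof cases
        case 1
        obtain u where u: "arr x u" "leq u M" using upper_cover 3 x aD MV by metis
        have "u = z" using upper_cover_unique u 1 ns by blast
        then show ?thesis using u trans[of m x z] x mV aD 1 arrD by blast
      next
        case 2
        obtain u where u: "arr u x" "leq m u" using lower_cover 3 x aD mV by metis
        have "u = z" using hasse_cycle.upper_cover_unique[OF dual_cycle, of x u z] u 2 ns by simp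
        then show ?thesis using u trans[of z x M] x MV aD 2 arrD by blast
      qed
    qed
  qed
  have "adj\<^sup>*\<^sup>* m x" using conn mV x by blast
  then show ?thesis
  proof induction
    case base
    then show ?case using refl mV mM by blast
  next
    case (step y z)
    then show ?case using closed by blast
  qed
qed

text \<open>Each of the two lower covers of \<open>M\<close> is no sink and so lies over exactly one
  source. The two sources differ, since otherwise \<open>interval_is_everything\<close> would leave
  \<open>M\<close> as the only sink.\<close>

lemma two_sources_below_sink:
  assumes s: "2 \<le> card sinks" and M: "M \<in> sinks"
  shows "card {m \<in> sources. leq m M} = 2"
proof -
  have MV: "M \<in> V" using M sinks_iff by blast
  obtain y y' where y: "y \<noteq> y'" "adj M y" "adj M y'" using two MV by blast
  then have ar: "arr y M" "arr y' M" using M sinks_iff unfolding hasse_adj_def by blast+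
  note yD = arrD[OF ar(1)] arrD[OF ar(2)]
  have ns: "y \<notin> sinks" "y' \<notin> sinks" using ar sinks_iff by blast+
  obtain m where m: "{m \<in> sources. leq m y} = {m}"
    using hasse_cycle.unique_sink_above[OF dual_cycle, of y] ns yD by (auto simp: card_1_singleton_iff)
  obtain m' where m': "{m \<in> sources. leq m y'} = {m'}"
    using hasse_cycle.unique_sink_above[OF dual_cycle, of y'] ns yD by (auto simp: card_1_singleton_iff)
  have mm: "m \<noteq> m'"
  proof
    assume "m = m'"
    then have "sinks \<subseteq> {M}"
      using interval_is_everything[of m M y y'] m m' M ar y sink_maximal sinks_iff MV by blast
    then have "card sinks \<le> 1" using card_mono[of "{M}" sinks] by simp
    then show False using s by simp
  qed
  have "{m \<in> sources. leq m M} = {m \<in> sources. leq m y} \<union> {m \<in> sources. leq m y'}"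
  proof (intro equalityI subsetI)
    fix k assume k: "k \<in> {m \<in> sources. leq m M}"
    have "M \<notin> sources" using ar sources_iff by blast
    then have "k \<noteq> M" using k by blast
    then obtain l where l: "arr l M" "leq k l" using lower_cover[of k M] k MV sources_iff by blast
    then have "l = y \<or> l = y'" using deg[of M l y y'] y arr_adj by blast
    then show "k \<in> {m \<in> sources. leq m y} \<union> {m \<in> sources. leq m y'}" using k l by blast
  next
    fix k assume k: "k \<in> {m \<in> sources. leq m y} \<union> {m \<in> sources. leq m y'}"
    then show "k \<in> {m \<in> sources. leq m M}" using trans[of k _ M] yD MV sources_iff by blast
  qed
  then show ?thesis using m m' mm by simp
qed

lemma two_sinks_above_source:
  assumes s: "2 \<le> card sinks" and m: "m \<in> sources"
  shows "card {M \<in> sinks. leq m M} = 2"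
proof -
  \<comment> \<open>Dualising \<open>two_sources_below_sink\<close> asks for two sources; those
    below any one sink suffice.\<close>
  have "2 \<le> card sources"
  proof (rule ccontr)
    assume c: "\<not> 2 \<le> card sources"
    obtain M M' where M: "M \<in> sinks" "M' \<in> sinks" "M \<noteq> M'"
      using s by (metis card_le_Suc0_iff_eq finite.emptyI card.infinite not_less_eq_eq numeral_2_eq_2 One_nat_def zero_le)
    have "finite sources" unfolding hasse_sinks_def by simp
    then have "card {m \<in> sources. leq m M} \<le> card sources" by (rule card_mono) blast
    then show False using two_sources_below_sink[OF s M(1)] c by linarith
  qed
  then show ?thesis
    using hasse_cycle.two_sources_below_sink[OF dual_cycle _ m] by simp
qed

end

section \<open>The root lattice of type A\<close>

text \<open>Coordinate \<open>l\<close> of \<open>e_a - e_(a+1)\<close>. The ring is left open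
  because lattice vectors live over the integers and positivity over the reals.\<close>

definition simple_root :: "nat \<Rightarrow> nat \<Rightarrow> 'a :: ring_1" where
  "simple_root l a = of_bool (l = a) - of_bool (l = Suc a)"

definition root_mat :: "nat \<Rightarrow> 'a :: ring_1 mat" where
  "root_mat m = mat (Suc m) m (\<lambda>(l, a). simple_root l a)"

lemma root_mat_carrier [simp]: "root_mat m \<in> carrier_mat (Suc m) m"
  unfolding root_mat_def by simp

lemma root_mat_dim [simp]: "dim_row (root_mat m) = Suc m" "dim_col (root_mat m) = m"
  unfolding root_mat_def by simp_all

lemma map_root_mat: "map_mat of_int (root_mat m) = root_mat m"
  unfolding root_mat_def simple_root_def by (rule eq_matI) auto

text \<open>\<open>root_mat\<close> is the difference operator on \<open>x\<close> padded by 0 at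
  both ends. So it is injective, and it maps the indicator of an interval to a difference of two
  unit vectors.\<close>

lemma root_mat_mult_vec_index:
  assumes "x \<in> carrier_vec m" "l \<le> m"
  shows "(root_mat m *\<^sub>v x) $ l = (if l < m then x $ l else 0) - (if 0 < l then x $ (l - 1) else 0)"
proof -
  have "(root_mat m *\<^sub>v x) $ l = (\<Sum>a<m. simple_root l a * x $ a)"
    using assms by (auto simp: root_mat_def scalar_prod_def lessThan_atLeast0 intro!: sum.cong)
  also have "\<dots> = (\<Sum>a<m. if a = l then x $ a else 0) - (\<Sum>a<m. if Suc a = l then x $ a else 0)"
    unfolding sum_subtractf[symmetric] by (rule sum.cong) (auto simp: simple_root_def)
  also have "(\<Sum>a<m. if a = l then x $ a else 0) = (if l < m then x $ l else 0)" by simp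
  also have "(\<Sum>a<m. if Suc a = l then x $ a else 0) = (if 0 < l then x $ (l - 1) else 0)"
    using assms(2) by (cases l) auto
  finally show ?thesis .
qed

text \<open>Simple roots have norm 2 and neighbouring ones product -1; hence the factor one
  half.\<close>

lemma gram_A_factor: "gram_A m = (1/2) \<cdot>\<^sub>m (transpose_mat (root_mat m) * root_mat m)"
proof (rule eq_matI)
  fix i j assume "i < dim_row ((1/2) \<cdot>\<^sub>m (transpose_mat (root_mat m) * (root_mat m :: real mat)))"
    "j < dim_col ((1/2) \<cdot>\<^sub>m (transpose_mat (root_mat m) * (root_mat m :: real mat)))"
  then have ij: "i < m" "j < m" by auto
  have "(\<Sum>l<Suc m. simple_root l i * simple_root l j :: real)
    = (\<Sum>l<Suc m. (if l = i then of_bool (i = j) - of_bool (i = Suc j) else 0)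
        + (if l = Suc i then of_bool (i = j) - of_bool (Suc i = j) else 0))"
    by (rule sum.cong) (auto simp: simple_root_def)
  also have "\<dots> = 2 * of_bool (i = j) - of_bool (i = Suc j) - of_bool (Suc i = j)"
    unfolding sum.distrib using ij by simp
  finally show "gram_A m $$ (i, j) = ((1/2) \<cdot>\<^sub>m (transpose_mat (root_mat m) * root_mat m)) $$ (i, j)"
    using ij by (auto simp: gram_A_def root_mat_def scalar_prod_def lessThan_atLeast0)
qed (auto simp: gram_A_def)

lemma gram_A_carrier [simp]: "gram_A m \<in> carrier_mat m m"
  unfolding gram_A_def by simp

text \<open>A congruence with \<open>gram_A\<close> thereby becomes a system of integer vectors, the
  columns of \<open>root_mat m * B\<close>. In this form the type is both established and
  exploited.\<close>

lemma gram_A_congruence: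
  assumes B: "B \<in> carrier_mat m m"
  shows "transpose_mat (map_mat of_int B) * gram_A m * map_mat of_int B
    = (1/2) \<cdot>\<^sub>m (transpose_mat (map_mat of_int (root_mat m * B)) * map_mat of_int (root_mat m * B))"
proof -
  let ?B = "map_mat of_int B :: real mat"
  let ?R = "root_mat m :: real mat"
  have BC: "?B \<in> carrier_mat m m" "transpose_mat ?B \<in> carrier_mat m m" using B by auto
  have RT: "transpose_mat ?R \<in> carrier_mat m (Suc m)" by simp
  have RR: "transpose_mat ?R * ?R \<in> carrier_mat m m" by (rule mult_carrier_mat[OF RT root_mat_carrier])
  have "map_mat of_int (root_mat m * B) = ?R * ?B"
    unfolding of_int_hom.mat_hom_mult[OF root_mat_carrier B] map_root_mat ..
  moreover have "transpose_mat (?R * ?B) = transpose_mat ?B * transpose_mat ?R"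
    using transpose_mult[OF root_mat_carrier BC(1)] .
  moreover have "transpose_mat ?B * transpose_mat ?R * (?R * ?B) = transpose_mat ?B * (transpose_mat ?R * ?R) * ?B"
  proof -
    have "transpose_mat ?B * transpose_mat ?R * (?R * ?B) = transpose_mat ?B * (transpose_mat ?R * (?R * ?B))"
      by (rule assoc_mult_mat[OF BC(2) RT mult_carrier_mat[OF root_mat_carrier BC(1)]])
    also have "transpose_mat ?R * (?R * ?B) = transpose_mat ?R * ?R * ?B"
      by (rule assoc_mult_mat[OF RT root_mat_carrier BC(1), symmetric])
    also have "transpose_mat ?B * (transpose_mat ?R * ?R * ?B) = transpose_mat ?B * (transpose_mat ?R * ?R) * ?B"
      by (rule assoc_mult_mat[OF BC(2) RR BC(1), symmetric])
    finally show ?thesis .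
  qed
  moreover have "transpose_mat ?B * gram_A m * ?B = (1/2) \<cdot>\<^sub>m (transpose_mat ?B * (transpose_mat ?R * ?R) * ?B)"
    unfolding gram_A_factor
    unfolding mult_smult_distrib[OF BC(2) RR] mult_smult_assoc_mat[OF mult_carrier_mat[OF BC(2) RR] BC(1)] ..
  ultimately show ?thesis by simp
qed

lemma half_gram_index:
  assumes W: "W \<in> carrier_mat k m" and "i < m" "j < m"
  shows "((1/2) \<cdot>\<^sub>m (transpose_mat (map_mat of_int W) * map_mat of_int W)) $$ (i, j)
    = (of_int (\<Sum>l<k. W $$ (l, i) * W $$ (l, j)) / 2 :: real)"
  using assms by (auto simp: scalar_prod_def lessThan_atLeast0)

section \<open>Positive definiteness of forms congruent to type A\<close>

definition posdef :: "nat \<Rightarrow> real mat \<Rightarrow> bool" where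
  "posdef m A \<longleftrightarrow> (\<forall>x \<in> carrier_vec m. x \<noteq> 0\<^sub>v m \<longrightarrow> 0 < x \<bullet> (A *\<^sub>v x))"

lemma posdef_imp_pos_semidef:
  assumes "posdef m A" "A \<in> carrier_mat m m"
  shows "pos_semidef m A"
  unfolding pos_semidef_def
proof
  fix x :: "real vec" assume x: "x \<in> carrier_vec m"
  show "0 \<le> x \<bullet> (A *\<^sub>v x)"
  proof (cases "x = 0\<^sub>v m")
    case True
    then show ?thesis using assms(2) by simp
  next
    case False
    then show ?thesis using assms(1) x unfolding posdef_def by fastforce
  qed
qed

lemma posdef_rank:
  assumes p: "posdef m A" and A: "A \<in> carrier_mat m m"
  shows "vec_space.rank m A = m"
proof -
  have "det A \<noteq> 0"
  proof
    assume "det A = 0"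
    then obtain v where v: "v \<in> carrier_vec m" "v \<noteq> 0\<^sub>v m" "A *\<^sub>v v = 0\<^sub>v m"
      using det_0_iff_vec_prod_zero[OF A] by blast
    then have "v \<bullet> (A *\<^sub>v v) = 0" by simp
    then show False using p v unfolding posdef_def by fastforce
  qed
  then show ?thesis using vec_space.det_rank_iff[OF A] by blast
qed

lemma smult_mat_mult_vec:
  fixes A :: "'a :: comm_semiring_0 mat"
  assumes "A \<in> carrier_mat m k" "x \<in> carrier_vec k"
  shows "(c \<cdot>\<^sub>m A) *\<^sub>v x = c \<cdot>\<^sub>v (A *\<^sub>v x)"
  using assms by (intro eq_vecI) auto

text \<open>The value at \<open>x\<close> is half the squared length of \<open>root_mat m\<close>
  applied to \<open>y = B x\<close>. If it vanishes, all differences of \<open>y\<close> vanish,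
  hence \<open>y = 0\<close>, and \<open>C\<close> recovers \<open>x = 0\<close>.\<close>

lemma gram_congruence_posdef:
  assumes B: "B \<in> carrier_mat m m" and C: "C \<in> carrier_mat m m" and CB: "C * B = 1\<^sub>m m"
  shows "posdef m (transpose_mat (map_mat of_int B) * gram_A m * map_mat of_int B)"
  unfolding posdef_def
proof (intro ballI impI)
  fix x :: "real vec" assume x: "x \<in> carrier_vec m" and x0: "x \<noteq> 0\<^sub>v m"
  let ?B = "map_mat of_int B :: real mat"
  let ?R = "root_mat m :: real mat"
  define W where "W = ?R * ?B"
  define y where "y = ?B *\<^sub>v x"
  have W: "W \<in> carrier_mat (Suc m) m"
    unfolding W_def by (rule mult_carrier_mat[OF root_mat_carrier]) (use B in simp)
  have y: "y \<in> carrier_vec m" unfolding y_def using B x by simp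
  have Wx: "W *\<^sub>v x = ?R *\<^sub>v y"
    unfolding W_def y_def using B x by (intro assoc_mult_mat_vec[of _ "Suc m" m _ m]) auto
  have "map_mat of_int C *\<^sub>v y = map_mat of_int (C * B) *\<^sub>v x"
    unfolding y_def of_int_hom.mat_hom_mult[OF C B]
    using B C x by (intro assoc_mult_mat_vec[of _ m m _ m, symmetric]) auto
  also have "\<dots> = x" unfolding CB using x by (simp add: of_int_hom.mat_hom_one)
  finally have Cy: "map_mat of_int C *\<^sub>v y = x" .
  have WT: "transpose_mat W *\<^sub>v (W *\<^sub>v x) \<in> carrier_vec m" using W x by simp
  have "x \<bullet> ((transpose_mat ?B * gram_A m * ?B) *\<^sub>v x) = x \<bullet> (((1/2) \<cdot>\<^sub>m (transpose_mat W * W)) *\<^sub>v x)"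
    unfolding gram_A_congruence[OF B] of_int_hom.mat_hom_mult[OF root_mat_carrier B] map_root_mat W_def ..
  also have "((1/2) \<cdot>\<^sub>m (transpose_mat W * W)) *\<^sub>v x = (1/2) \<cdot>\<^sub>v ((transpose_mat W * W) *\<^sub>v x)"
    by (rule smult_mat_mult_vec[OF _ x, of _ m]) (use W in simp)
  also have "(transpose_mat W * W) *\<^sub>v x = transpose_mat W *\<^sub>v (W *\<^sub>v x)"
    using W x by (intro assoc_mult_mat_vec[of _ m "Suc m" _ m]) auto
  also have "x \<bullet> ((1/2) \<cdot>\<^sub>v (transpose_mat W *\<^sub>v (W *\<^sub>v x))) = (1/2) * (x \<bullet> (transpose_mat W *\<^sub>v (W *\<^sub>v x)))"
    using WT x by simp
  also have "x \<bullet> (transpose_mat W *\<^sub>v (W *\<^sub>v x)) = (W *\<^sub>v x) \<bullet> (W *\<^sub>v x)"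
    using transpose_vec_mult_scalar[OF W x, of "W *\<^sub>v x"] W x
    by (subst comm_scalar_prod[of _ m]) auto
  also have "\<dots> = (\<Sum>l<Suc m. ((?R *\<^sub>v y) $ l)\<^sup>2)"
    unfolding Wx by (simp add: scalar_prod_def lessThan_atLeast0 power2_eq_square)
  finally have eq: "x \<bullet> ((transpose_mat ?B * gram_A m * ?B) *\<^sub>v x) = (1/2) * (\<Sum>l<Suc m. ((?R *\<^sub>v y) $ l)\<^sup>2)" .
  have "(\<Sum>l<Suc m. ((?R *\<^sub>v y) $ l)\<^sup>2) \<noteq> 0"
  proof
    assume "(\<Sum>l<Suc m. ((?R *\<^sub>v y) $ l)\<^sup>2) = 0"
    then have z: "(?R *\<^sub>v y) $ l = 0" if "l \<le> m" for l
      using that by (subst (asm) sum_nonneg_eq_0_iff) auto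
    have "y $ l = 0" if "l < m" for l
      using that
    proof (induction l)
      case 0
      then show ?case using z[of 0] root_mat_mult_vec_index[OF y, of 0] by simp
    next
      case (Suc l)
      then show ?case using z[of "Suc l"] root_mat_mult_vec_index[OF y, of "Suc l"] by simp
    qed
    then have "y = 0\<^sub>v m" using y by (intro eq_vecI) auto
    then have "x = map_mat of_int C *\<^sub>v 0\<^sub>v m" using Cy by simp
    also have "\<dots> = 0\<^sub>v m" using C by (intro eq_vecI) auto
    finally have "x = 0\<^sub>v m" .
    then show False using x0 by simp
  qed
  moreover have "0 \<le> (\<Sum>l<Suc m. ((?R *\<^sub>v y) $ l)\<^sup>2)" by (rule sum_nonneg) simp
  ultimately show "0 < x \<bullet> ((transpose_mat ?B * gram_A m * ?B) *\<^sub>v x)" unfolding eq by linarith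
qed

text \<open>The determinant is 1 or -1 and hence its own inverse, so \<open>det T\<close> times the
  adjugate is an inverse over the integers.\<close>

lemma unit_upper_triangular_invertible:
  fixes T :: "int mat"
  assumes T: "T \<in> carrier_mat m m" and u: "upper_triangular T"
    and d: "\<And>i. i < m \<Longrightarrow> \<bar>T $$ (i, i)\<bar> = 1"
  shows "\<exists>S \<in> carrier_mat m m. S * T = 1\<^sub>m m \<and> T * S = 1\<^sub>m m"
proof -
  have "\<bar>det T\<bar> = (\<Prod>i<m. \<bar>T $$ (i, i)\<bar>)"
    unfolding det_upper_triangular[OF u T] prod_list_diag_prod using T
    by (simp add: abs_prod lessThan_atLeast0)
  also have "\<dots> = 1" using d by simp
  finally have "det T * det T = 1" by (metis abs_mult_self_eq mult_1)
  moreover have "adj_mat T \<in> carrier_mat m m" "T * adj_mat T = det T \<cdot>\<^sub>m 1\<^sub>m m" "adj_mat T * T = det T \<cdot>\<^sub>m 1\<^sub>m m"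
    using adj_mat[OF T] by auto
  ultimately show ?thesis using T
    by (intro bexI[of _ "det T \<cdot>\<^sub>m adj_mat T"])
      (auto simp: mult_smult_distrib[OF T] mult_smult_assoc_mat[of _ m m _ m])
qed

text \<open>Triangularity is visible only in the order of the path, whereas the Gram matrix is
  indexed by labels; \<open>q\<close> will pass from labels to positions.\<close>

lemma permute_cols_invertible:
  fixes T :: "int mat"
  assumes T: "T \<in> carrier_mat m m" and S: "S \<in> carrier_mat m m" "S * T = 1\<^sub>m m" "T * S = 1\<^sub>m m"
    and q: "bij_betw q {..<m} {..<m}"
    and B: "B = mat m m (\<lambda>(l, i). T $$ (l, q i))"
    and C: "C = mat m m (\<lambda>(i, l). S $$ (q i, l))"
  shows "C * B = 1\<^sub>m m" "B * C = 1\<^sub>m m"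
proof -
  have qm: "q i < m" if "i < m" for i using q that by (auto simp: bij_betw_def)
  have qe: "q i = q j \<longleftrightarrow> i = j" if "i < m" "j < m" for i j
    using q that by (auto simp: bij_betw_def inj_on_def)
  show "C * B = 1\<^sub>m m"
  proof (rule eq_matI)
    fix i j assume "i < dim_row (1\<^sub>m m :: int mat)" "j < dim_col (1\<^sub>m m :: int mat)"
    then have ij: "i < m" "j < m" by auto
    have "(C * B) $$ (i, j) = (\<Sum>l<m. S $$ (q i, l) * T $$ (l, q j))"
      unfolding B C using ij by (auto simp: scalar_prod_def lessThan_atLeast0)
    also have "\<dots> = (S * T) $$ (q i, q j)"
      using S(1) T ij qm by (auto simp: scalar_prod_def lessThan_atLeast0)
    finally show "(C * B) $$ (i, j) = 1\<^sub>m m $$ (i, j)"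
      unfolding S(2) using ij qm qe by simp
  qed (auto simp: B C)
  show "B * C = 1\<^sub>m m"
  proof (rule eq_matI)
    fix i j assume "i < dim_row (1\<^sub>m m :: int mat)" "j < dim_col (1\<^sub>m m :: int mat)"
    then have ij: "i < m" "j < m" by auto
    have "(B * C) $$ (i, j) = (\<Sum>l<m. T $$ (i, q l) * S $$ (q l, j))"
      unfolding B C using ij by (auto simp: scalar_prod_def lessThan_atLeast0)
    also have "\<dots> = (\<Sum>l<m. T $$ (i, l) * S $$ (l, j))"
      using sum.reindex_bij_betw[OF q, of "\<lambda>l. T $$ (i, l) * S $$ (l, j)"] .
    also have "\<dots> = (T * S) $$ (i, j)"
      using S(1) T ij by (auto simp: scalar_prod_def lessThan_atLeast0)
    finally show "(B * C) $$ (i, j) = 1\<^sub>m m $$ (i, j)"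
      unfolding S(3) .
  qed (auto simp: B C)
qed

section \<open>Oriented paths\<close>

definition dbl_gram :: "(nat \<Rightarrow> nat \<Rightarrow> bool) \<Rightarrow> nat \<Rightarrow> nat \<Rightarrow> int" where
  "dbl_gram leq i j = of_bool (leq i j) + of_bool (leq j i)"

lemma gram_mat_index:
  "i < n \<Longrightarrow> j < n \<Longrightarrow> gram_mat n leq $$ (i, j) = of_int (dbl_gram leq (Suc i) (Suc j)) / 2"
  unfolding gram_mat_def incidence_mat_def dbl_gram_def by auto

lemma gram_mat_carrier [simp]: "gram_mat n leq \<in> carrier_mat n n"
  unfolding gram_mat_def incidence_mat_def by simp

lemma gram_mat_dim [simp]: "dim_row (gram_mat n leq) = n" "dim_col (gram_mat n leq) = n"
  unfolding gram_mat_def incidence_mat_def by simp_all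

text \<open>Along a path with vertices \<open>0, 1, \<dots>\<close>, where \<open>u l\<close> tells whether the edge
  \<open>{l, l + 1}\<close> is oriented upwards, vertex \<open>a\<close> is realised by the root
  \<open>\<plusminus>(e\<^sub>c - e\<^sub>a\<^sub>+\<^sub>1)\<close>. All vertices of one monotone stretch share the coordinate \<open>c\<close>, and
  the sign alternates from one stretch to the next; the vertex \<open>c - 1\<close> where the
  stretch begins carries this coordinate with the same sign.\<close>

fun chain_node :: "(nat \<Rightarrow> bool) \<Rightarrow> nat \<Rightarrow> nat" where
  "chain_node u 0 = 0"
| "chain_node u (Suc a) = (if 1 \<le> a \<and> u a \<noteq> u (a - 1) then Suc a else chain_node u a)"

text \<open>Vertex \<open>a\<close> takes the direction of the edge before it. At
  \<open>a = 0\<close> truncated subtraction gives \<open>u 0\<close>, so the first vertex shares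
  the sign of the first stretch.\<close>

definition chain_sign :: "(nat \<Rightarrow> bool) \<Rightarrow> nat \<Rightarrow> int" where
  "chain_sign u a = (if u (a - 1) then 1 else - 1)"

definition path_root :: "(nat \<Rightarrow> bool) \<Rightarrow> nat \<Rightarrow> nat \<Rightarrow> int" where
  "path_root u a l = chain_sign u a * (of_bool (l = chain_node u a) - of_bool (l = Suc a))"

text \<open>By telescoping, \<open>e_c - e_(a+1)\<close> is the sum of the simple roots from
  \<open>c\<close> to \<open>a\<close>. The last coefficient stands at \<open>a\<close> and is 1 or
  -1, which makes the coefficient matrix triangular.\<close>

definition path_coeff :: "(nat \<Rightarrow> bool) \<Rightarrow> nat \<Rightarrow> nat \<Rightarrow> int" where
  "path_coeff u a l = chain_sign u a * of_bool (chain_node u a \<le> l \<and> l \<le> a)"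

lemma chain_node_le: "chain_node u a \<le> a"
  by (induction a) auto

lemma chain_sign_square [simp]: "chain_sign u a * chain_sign u a = 1"
  unfolding chain_sign_def by simp

lemma path_root_product:
  assumes "a < N" "b < N"
  shows "(\<Sum>l<Suc N. path_root u a l * path_root u b l) = chain_sign u a * chain_sign u b *
    (of_bool (chain_node u a = chain_node u b) - of_bool (chain_node u a = Suc b)
      - of_bool (chain_node u b = Suc a) + of_bool (a = b))"
proof -
  have "(\<Sum>l<Suc N. path_root u a l * path_root u b l) = (\<Sum>l<Suc N.
      (if l = chain_node u a then chain_sign u a * chain_sign u b *
         (of_bool (chain_node u a = chain_node u b) - of_bool (chain_node u a = Suc b)) else 0) +
      (if l = Suc a then chain_sign u a * chain_sign u b *
         (of_bool (a = b) - of_bool (chain_node u b = Suc a)) else 0))"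
    by (rule sum.cong) (auto simp: path_root_def algebra_simps)
  also have "\<dots> = chain_sign u a * chain_sign u b *
         (of_bool (chain_node u a = chain_node u b) - of_bool (chain_node u a = Suc b)) +
      chain_sign u a * chain_sign u b * (of_bool (a = b) - of_bool (chain_node u b = Suc a))"
    unfolding sum.distrib using assms chain_node_le[of u a] by simp
  finally show ?thesis by (simp add: algebra_simps)
qed

text \<open>For \<open>d = 0\<close> the stretch is a single edge: the vertices share a node with
  equal signs, or the path turns at \<open>a\<close> and both carry coordinate \<open>Suc a\<close>
  with the same sign. A further edge in the same direction changes neither node nor sign. A turn
  creates a node beyond \<open>chain_node u a\<close> and \<open>Suc a\<close>, so the product
  becomes 0 just when monotonicity fails.\<close>

lemma chain_product:
  "chain_sign u a * chain_sign u (Suc a + d) *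
      (of_bool (chain_node u a = chain_node u (Suc a + d)) - of_bool (chain_node u (Suc a + d) = Suc a))
    = of_bool ((\<forall>l\<in>{a..<Suc a + d}. u l) \<or> (\<forall>l\<in>{a..<Suc a + d}. \<not> u l))"
proof (induction d)
  case 0
  have "chain_node u a \<noteq> Suc a" using chain_node_le[of u a] by simp
  then show ?case by (cases a) (auto simp: chain_sign_def)
next
  case (Suc d)
  have ivl: "{a..<Suc (Suc (a + d))} = insert (Suc (a + d)) {a..<Suc (a + d)}" by auto
  show ?case
  proof (cases "u (Suc (a + d)) = u (a + d)")
    case True
    have 1: "chain_node u (Suc a + Suc d) = chain_node u (Suc a + d)"
      "chain_sign u (Suc a + Suc d) = chain_sign u (Suc a + d)"
      using True by (auto simp: chain_sign_def)
    have 2: "((\<forall>l\<in>{a..<Suc a + Suc d}. u l) \<or> (\<forall>l\<in>{a..<Suc a + Suc d}. \<not> u l)) \<longleftrightarrow>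
       ((\<forall>l\<in>{a..<Suc a + d}. u l) \<or> (\<forall>l\<in>{a..<Suc a + d}. \<not> u l))"
      using True by (auto simp: ivl)
    show ?thesis unfolding 1 2 by (rule Suc)
  next
    case False
    then have "chain_node u (Suc a + Suc d) = Suc (Suc (a + d))" by simp
    moreover have "chain_node u a \<noteq> Suc (Suc (a + d))" using chain_node_le[of u a] by simp
    moreover have "\<not> ((\<forall>l\<in>{a..<Suc a + Suc d}. u l) \<or> (\<forall>l\<in>{a..<Suc a + Suc d}. \<not> u l))"
      using False by (auto simp: ivl)
    ultimately show ?thesis by simp
  qed
qed

lemma path_root_product_less:
  assumes "a < b" "b < N"
  shows "(\<Sum>l<Suc N. path_root u a l * path_root u b l)
    = of_bool ((\<forall>l\<in>{a..<b}. u l) \<or> (\<forall>l\<in>{a..<b}. \<not> u l))"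
proof -
  obtain d where d: "b = Suc a + d" using assms less_imp_Suc_add by auto
  have "chain_node u a \<noteq> Suc b" "a \<noteq> b" using chain_node_le[of u a] assms by auto
  then show ?thesis using path_root_product[of a N b u] chain_product[of u a d] assms
    unfolding d by simp
qed

lemma root_mat_path_coeff:
  assumes "a < N" "l \<le> N"
  shows "(\<Sum>j<N. simple_root l j * path_coeff u a j) = path_root u a l"
proof -
  have "(\<Sum>j<N. simple_root l j * path_coeff u a j)
    = (root_mat N *\<^sub>v vec N (path_coeff u a)) $ l"
    using assms by (auto simp: root_mat_def scalar_prod_def lessThan_atLeast0 intro!: sum.cong)
  also have "\<dots> = (if l < N then path_coeff u a l else 0) - (if 0 < l then path_coeff u a (l - 1) else 0)"
    using assms by (subst root_mat_mult_vec_index) auto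
  also have "\<dots> = path_root u a l"
    using assms chain_node_le[of u a] by (cases l) (auto simp: path_coeff_def path_root_def)
  finally show ?thesis .
qed

section \<open>The order and the Gram matrix of an oriented path\<close>

context fin_poset
begin

text \<open>The order is reachability along arrows, and a directed walk on a path cannot turn back
  because each edge has one direction. So comparable pairs bound exactly the monotone
  stretches.\<close>

lemma path_leq:
  assumes p: "bij_betw p {0..<n} V"
    and e: "\<And>a b. a < n \<Longrightarrow> b < n \<Longrightarrow> adj (p a) (p b) \<longleftrightarrow> (a + 1 = b \<or> b + 1 = a)"
    and ab: "a \<le> b" "b < n"
  shows "leq (p a) (p b) \<longleftrightarrow> (\<forall>l\<in>{a..<b}. arr (p l) (p (Suc l)))" (is "?up1 \<longleftrightarrow> ?up2")
    and "leq (p b) (p a) \<longleftrightarrow> (\<forall>l\<in>{a..<b}. \<not> arr (p l) (p (Suc l)))" (is "?dn1 \<longleftrightarrow> ?dn2")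
proof -
  have pV: "p a \<in> V" if "a < n" for a using p that by (auto simp: bij_betw_def)
  have inj: "p a = p b \<longleftrightarrow> a = b" if "a < n" "b < n" for a b
    using p that by (auto simp: bij_betw_def inj_on_def)
  have anti: "\<not> arr y x" if "arr x y" for x y using arrD[OF that] antisym arrD by blast
  have opp: "arr (p (Suc l)) (p l) \<longleftrightarrow> \<not> arr (p l) (p (Suc l))" if "Suc l < n" for l
    using e[of l "Suc l"] that anti unfolding hasse_adj_def by auto
  \<comment> \<open>At the start both alternatives hold vacuously. The first arrow selects one of
    them, and an arrow the other way would reverse an edge already used.\<close>
  have walk: "(a \<le> b \<and> (\<forall>l\<in>{a..<b}. arr (p l) (p (Suc l)))) \<or>
      (b \<le> a \<and> (\<forall>l\<in>{b..<a}. \<not> arr (p l) (p (Suc l))))"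
    if r: "arr\<^sup>*\<^sup>* (p a) y" and a: "a < n" and b: "b < n" and y: "y = p b" for a b y
    using r b y
  proof (induction arbitrary: b)
    case base
    then have "a = b" using inj a by blast
    then show ?case by simp
  next
    case (step y z)
    have "y \<in> p ` {0..<n}" using arrD(1)[OF step.hyps(2)] p by (simp only: bij_betw_def)
    then obtain b' where b': "b' < n" "y = p b'" by auto
    note IH = step.IH[OF b']
    have ar: "arr (p b') (p b)" using step.hyps(2) step.prems(2) b'(2) by simp
    then have "adj (p b') (p b)" unfolding hasse_adj_def by blast
    then consider "b = Suc b'" | "b' = Suc b" using e[OF b'(1) step.prems(1)] by auto
    then show ?case
    proof cases
      case 1
      show ?thesis
      proof (cases "a \<le> b'")
        case True
        have "arr (p l) (p (Suc l))" if "l \<in> {a..<b}" for l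
        proof (cases "l = b'")
          case True
          then show ?thesis using ar 1 by simp
        next
          case False
          then have "a < b'" "l \<in> {a..<b'}" using that 1 by auto
          then show ?thesis using IH by auto
        qed
        then show ?thesis using True 1 by auto
      next
        case False
        then have "\<not> arr (p b') (p (Suc b'))" using IH by auto
        then show ?thesis using ar 1 by simp
      qed
    next
      case 2
      then have no: "\<not> arr (p b) (p (Suc b))" using ar opp[of b] b' by simp
      show ?thesis
      proof (cases "b' \<le> a")
        case True
        have "\<not> arr (p l) (p (Suc l))" if "l \<in> {b..<a}" for l
        proof (cases "l = b")
          case True
          then show ?thesis using no by simp
        next
          case False
          then have "b' < a" "l \<in> {b'..<a}" using that 2 by auto
          then show ?thesis using IH by auto
        qed
        then show ?thesis using True 2 by auto
      next
        case False
        then have "b \<in> {a..<b'}" using 2 by auto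
        moreover have "\<not> b' \<le> a" using False .
        ultimately have "arr (p b) (p (Suc b))" using IH by blast
        then show ?thesis using no by simp
      qed
    qed
  qed
  have le: "leq x y \<Longrightarrow> x \<in> V \<Longrightarrow> y \<in> V \<Longrightarrow> arr\<^sup>*\<^sup>* x y" for x y using leq_arr_rtrancl by blast
  have an: "a < n" using ab by simp
  have up: "leq (p a) (p b)" if "\<forall>l\<in>{a..<b}. arr (p l) (p (Suc l))" "a \<le> b" "b < n" for a b
    using that(2,1,3)
  proof (induction b rule: dec_induct)
    case base
    then show ?case using refl pV by blast
  next
    case (step b)
    then have l: "leq (p a) (p b)" and ar: "arr (p b) (p (Suc b))" by auto
    have "p a \<in> V" using pV step.hyps step.prems by simp
    then show ?case using trans[OF _ arrD(1,2)[OF ar] l arrD(3)[OF ar]] by blast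
  qed
  have dn: "leq (p b) (p a)" if "\<forall>l\<in>{a..<b}. \<not> arr (p l) (p (Suc l))" "a \<le> b" "b < n" for a b
    using that(2,1,3)
  proof (induction b rule: dec_induct)
    case base
    then show ?case using refl pV by blast
  next
    case (step b)
    then have l: "leq (p b) (p a)" and ar: "arr (p (Suc b)) (p b)" using opp[of b] by auto
    have "p a \<in> V" using pV step.hyps step.prems by simp
    then show ?case using trans[OF arrD(1,2)[OF ar] _ arrD(3)[OF ar] l] by blast
  qed
  show "?up1 \<longleftrightarrow> ?up2"
  proof
    assume ?up1
    then show ?up2 using walk[OF le an ab(2)] pV an ab by fastforce
  qed (use up ab in blast)
  show "?dn1 \<longleftrightarrow> ?dn2"
  proof
    assume ?dn1
    then show ?dn2 using walk[OF le ab(2) an] pV an ab by fastforce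
  qed (use dn ab in blast)
qed

text \<open>The columns of \<open>B\<close> are the coefficients of the path roots in the simple
  roots, rearranged from path order to label order. The products of these roots were computed to be
  1 on monotone stretches and 0 otherwise, which by \<open>path_leq\<close> is the Gram
  matrix.\<close>

theorem oriented_path_congruence:
  assumes "hasse_oriented_path n leq"
  shows "\<exists>B \<in> carrier_mat n n. \<exists>C \<in> carrier_mat n n. C * B = 1\<^sub>m n \<and> B * C = 1\<^sub>m n \<and>
    gram_mat n leq = transpose_mat (map_mat of_int B) * gram_A n * map_mat of_int B"
proof -
  obtain p where p: "bij_betw p {0..<n} V"
    and e: "\<And>a b. a < n \<Longrightarrow> b < n \<Longrightarrow> adj (p a) (p b) \<longleftrightarrow> (a + 1 = b \<or> b + 1 = a)"
    using assms unfolding hasse_oriented_path_def by blast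
  have pV: "p a \<in> V" if "a < n" for a using p that by (auto simp: bij_betw_def)
  define u where "u l = arr (p l) (p (Suc l))" for l
  \<comment> \<open>The position on the path of the element \<open>Suc i\<close>, for which the
    matrix index \<open>i\<close> stands.\<close>
  define q where "q i = inv_into {0..<n} p (Suc i)" for i
  define T where "T = mat n n (\<lambda>(l, a). path_coeff u a l)"
  have "bij_betw (inv_into {0..<n} p) V {0..<n}" using p by (rule bij_betw_inv_into)
  moreover have "bij_betw Suc {..<n} V" by (simp add: bij_betw_def image_Suc_lessThan)
  ultimately have q: "bij_betw q {..<n} {..<n}"
    using bij_betw_trans[of Suc "{..<n}" V "inv_into {0..<n} p" "{0..<n}"]
    by (simp add: q_def[abs_def] comp_def lessThan_atLeast0)
  have qn: "q i < n" if "i < n" for i using q that by (auto simp: bij_betw_def)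
  have pq: "p (q i) = Suc i" if "i < n" for i
    unfolding q_def using p that by (intro f_inv_into_f) (auto simp: bij_betw_def)
  have T: "T \<in> carrier_mat n n" unfolding T_def by simp
  have "upper_triangular T" unfolding T_def path_coeff_def by auto
  moreover have "\<bar>T $$ (i, i)\<bar> = 1" if "i < n" for i
    using that chain_node_le[of u i] by (auto simp: T_def path_coeff_def chain_sign_def)
  ultimately obtain S where S: "S \<in> carrier_mat n n" "S * T = 1\<^sub>m n" "T * S = 1\<^sub>m n"
    using unit_upper_triangular_invertible[OF T] by blast
  define B where "B = mat n n (\<lambda>(l, i). T $$ (l, q i))"
  define C where "C = mat n n (\<lambda>(i, l). S $$ (q i, l))"
  have BC: "B \<in> carrier_mat n n" "C \<in> carrier_mat n n" unfolding B_def C_def by auto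
  note inv = permute_cols_invertible[OF T S q B_def C_def]
  have W: "root_mat n * B \<in> carrier_mat (Suc n) n" by (rule mult_carrier_mat[OF root_mat_carrier BC(1)])
  have Wi: "(root_mat n * B) $$ (l, i) = path_root u (q i) l" if "l \<le> n" "i < n" for l i
    using that qn root_mat_path_coeff[of "q i" n l u]
    by (auto simp: root_mat_def B_def T_def scalar_prod_def lessThan_atLeast0 intro!: sum.cong)
  have root: "(\<Sum>l<Suc n. path_root u a l * path_root u b l) = dbl_gram leq (p a) (p b)"
    if ab: "a < n" "b < n" for a b
  proof -
    have lt: "(\<Sum>l<Suc n. path_root u a l * path_root u b l) = dbl_gram leq (p a) (p b)"
      if ab: "a < b" "b < n" for a b
    proof -
      have ne: "p a \<noteq> p b"
        using p ab inj_on_eq_iff[of p "{0..<n}" a b] by (auto simp: bij_betw_def)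
      have "\<not> (leq (p a) (p b) \<and> leq (p b) (p a))" using antisym ne pV ab by (meson less_trans)
      then show ?thesis
        using path_root_product_less[OF ab, of u] path_leq[OF p e, of a b] ab
        unfolding u_def dbl_gram_def by auto
    qed
    consider "a < b" | "b < a" | "a = b" by linarith
    then show ?thesis
    proof cases
      case 1
      then show ?thesis using lt ab by blast
    next
      case 2
      then show ?thesis using lt[of b a] ab by (simp add: mult.commute dbl_gram_def add.commute)
    next
      case 3
      have "chain_node u b \<noteq> Suc b" using chain_node_le[of u b] by simp
      then show ?thesis using path_root_product[of a n b u] ab refl[of "p b"] pV 3
        by (simp add: dbl_gram_def)
    qed
  qed
  have "gram_mat n leq = transpose_mat (map_mat of_int B) * gram_A n * map_mat of_int B"
    unfolding gram_A_congruence[OF BC(1)]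
  proof (rule eq_matI)
    fix i j assume "i < dim_row ((1/2) \<cdot>\<^sub>m (transpose_mat (map_mat of_int (root_mat n * B)) * (map_mat of_int (root_mat n * B) :: real mat)))"
      "j < dim_col ((1/2) \<cdot>\<^sub>m (transpose_mat (map_mat of_int (root_mat n * B)) * (map_mat of_int (root_mat n * B) :: real mat)))"
    then have ij: "i < n" "j < n" using W by auto
    have "(\<Sum>l<Suc n. (root_mat n * B) $$ (l, i) * (root_mat n * B) $$ (l, j))
        = (\<Sum>l<Suc n. path_root u (q i) l * path_root u (q j) l)"
      by (rule sum.cong) (use Wi ij in auto)
    also have "\<dots> = dbl_gram leq (Suc i) (Suc j)" using root qn pq ij by simp
    finally show "gram_mat n leq $$ (i, j) = ((1/2) \<cdot>\<^sub>m (transpose_mat (map_mat of_int (root_mat n * B)) * map_mat of_int (root_mat n * B))) $$ (i, j)"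
      unfolding half_gram_index[OF W ij] gram_mat_index[OF ij] by simp
  qed (use W BC in auto)
  then show ?thesis using BC inv by blast
qed

end

section \<open>Cycles with at least two sinks\<close>

text \<open>Twice the bilinear form of the Gram matrix, on functions of poset elements instead of
  0-based vectors: these restrict to subposets and combine without carrier conditions.\<close>

definition bform :: "nat \<Rightarrow> (nat \<Rightarrow> nat \<Rightarrow> bool) \<Rightarrow> (nat \<Rightarrow> real) \<Rightarrow> (nat \<Rightarrow> real) \<Rightarrow> real" where
  "bform n leq f g = (\<Sum>i\<in>{1..n}. \<Sum>j\<in>{1..n}. f i * of_int (dbl_gram leq i j) * g j)"

lemma dbl_gram_sym: "dbl_gram leq i j = dbl_gram leq j i"
  unfolding dbl_gram_def by simp

lemma bform_sym: "bform n leq f g = bform n leq g f"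
  unfolding bform_def by (subst sum.swap) (simp add: dbl_gram_sym[of leq] mult_ac)

lemma bform_add_left: "bform n leq (\<lambda>i. f i + c * g i) h = bform n leq f h + c * bform n leq g h"
  unfolding bform_def sum_distrib_left sum.distrib[symmetric] by (simp add: algebra_simps)

lemma bform_add_right: "bform n leq h (\<lambda>i. f i + c * g i) = bform n leq h f + c * bform n leq h g"
  using bform_add_left[of n leq f c g h] by (simp add: bform_sym)

lemma bform_cong:
  "(\<And>i. i \<in> {1..n} \<Longrightarrow> f i = f' i) \<Longrightarrow> (\<And>i. i \<in> {1..n} \<Longrightarrow> g i = g' i) \<Longrightarrow> bform n leq f g = bform n leq f' g'"
  unfolding bform_def by simp

lemma sum_Suc_shift: "(\<Sum>i<n. f (Suc i)) = (\<Sum>i\<in>{1..n}. f i)"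
  using sum.atLeast1_atMost_eq[of f n] by simp

lemma gram_mat_mult_index:
  assumes "x \<in> carrier_vec n" "i < n"
  shows "(gram_mat n leq *\<^sub>v x) $ i = (\<Sum>j\<in>{1..n}. of_int (dbl_gram leq (Suc i) j) * x $ (j - 1)) / 2"
proof -
  have "(gram_mat n leq *\<^sub>v x) $ i = (\<Sum>j<n. gram_mat n leq $$ (i, j) * x $ j)"
    using assms by (auto simp: scalar_prod_def lessThan_atLeast0 intro!: sum.cong)
  also have "\<dots> = (\<Sum>j<n. of_int (dbl_gram leq (Suc i) (Suc j)) * x $ (Suc j - 1) / 2)"
    using assms by (intro sum.cong) (auto simp: gram_mat_index)
  finally show ?thesis
    unfolding sum_Suc_shift[of "\<lambda>j. of_int (dbl_gram leq (Suc i) j) * x $ (j - 1) / 2"]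
    by (simp add: sum_divide_distrib)
qed

lemma gram_mat_bform:
  assumes "x \<in> carrier_vec n" "y \<in> carrier_vec n"
  shows "x \<bullet> (gram_mat n leq *\<^sub>v y) = bform n leq (\<lambda>i. x $ (i - 1)) (\<lambda>i. y $ (i - 1)) / 2"
proof -
  have "x \<bullet> (gram_mat n leq *\<^sub>v y) = (\<Sum>i<n. x $ i * (gram_mat n leq *\<^sub>v y) $ i)"
    using assms by (simp add: scalar_prod_def lessThan_atLeast0)
  also have "\<dots> = (\<Sum>i<n. x $ (Suc i - 1) * ((\<Sum>j\<in>{1..n}. of_int (dbl_gram leq (Suc i) j) * y $ (j - 1)) / 2))"
    using assms by (intro sum.cong) (auto simp: gram_mat_mult_index simp del: index_mult_mat_vec)
  also have "\<dots> = (\<Sum>i\<in>{1..n}. x $ (i - 1) * ((\<Sum>j\<in>{1..n}. of_int (dbl_gram leq i j) * y $ (j - 1)) / 2))"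
    by (rule sum_Suc_shift)
  also have "\<dots> = bform n leq (\<lambda>i. x $ (i - 1)) (\<lambda>i. y $ (i - 1)) / 2"
    unfolding bform_def sum_divide_distrib sum_distrib_left by (simp add: mult_ac)
  finally show ?thesis .
qed

lemma pos_semidef_gram_mat:
  "pos_semidef n (gram_mat n leq) \<longleftrightarrow> (\<forall>f. 0 \<le> bform n leq f f)"
proof
  assume p: "pos_semidef n (gram_mat n leq)"
  show "\<forall>f. 0 \<le> bform n leq f f"
  proof
    fix f
    have "bform n leq f f = bform n leq (\<lambda>i. vec n (\<lambda>i. f (Suc i)) $ (i - 1)) (\<lambda>i. vec n (\<lambda>i. f (Suc i)) $ (i - 1))"
      by (rule bform_cong) auto
    moreover have "0 \<le> vec n (\<lambda>i. f (Suc i)) \<bullet> (gram_mat n leq *\<^sub>v vec n (\<lambda>i. f (Suc i)))"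
      using p unfolding pos_semidef_def by simp
    ultimately show "0 \<le> bform n leq f f" by (simp add: gram_mat_bform)
  qed
qed (auto simp: pos_semidef_def gram_mat_bform)

lemma posdef_gram_mat_bform:
  assumes p: "posdef n (gram_mat n leq)" and i: "i \<in> {1..n}" "f i \<noteq> 0"
  shows "0 < bform n leq f f"
proof -
  let ?x = "vec n (\<lambda>i. f (Suc i))"
  have "?x $ (i - 1) \<noteq> 0\<^sub>v n $ (i - 1)" using i by auto
  then have "?x \<noteq> 0\<^sub>v n" by metis
  then have "0 < ?x \<bullet> (gram_mat n leq *\<^sub>v ?x)" using p unfolding posdef_def by simp
  moreover have "bform n leq f f = bform n leq (\<lambda>i. ?x $ (i - 1)) (\<lambda>i. ?x $ (i - 1))"
    by (rule bform_cong) auto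
  ultimately show ?thesis by (simp add: gram_mat_bform)
qed

lemma quad_form_bform:
  assumes "v \<in> carrier_vec n"
  shows "quad_form n leq v = bform n leq (\<lambda>i. of_int (v $ (i - 1))) (\<lambda>i. of_int (v $ (i - 1))) / 2"
proof -
  have "quad_form n leq v = bform n leq (\<lambda>i. map_vec of_int v $ (i - 1)) (\<lambda>i. map_vec of_int v $ (i - 1)) / 2"
    unfolding quad_form_def using assms by (intro gram_mat_bform) auto
  also have "bform n leq (\<lambda>i. map_vec of_int v $ (i - 1)) (\<lambda>i. map_vec of_int v $ (i - 1))
      = bform n leq (\<lambda>i. of_int (v $ (i - 1))) (\<lambda>i. of_int (v $ (i - 1)))"
    using assms by (intro bform_cong) auto
  finally show ?thesis .
qed

lemma bform_restrict:
  assumes e: "bij_betw e {1..m} R" and R: "R \<subseteq> {1..n}"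
    and f: "\<And>i. i \<in> {1..n} - R \<Longrightarrow> f i = 0" and g: "\<And>i. i \<in> {1..n} - R \<Longrightarrow> g i = 0"
  shows "bform n leq f g = bform m (\<lambda>a b. leq (e a) (e b)) (\<lambda>a. f (e a)) (\<lambda>a. g (e a))"
proof -
  have "bform n leq f g = (\<Sum>i\<in>R. \<Sum>j\<in>{1..n}. f i * of_int (dbl_gram leq i j) * g j)"
    unfolding bform_def using R f by (intro sum.mono_neutral_right) auto
  also have "\<dots> = (\<Sum>i\<in>R. \<Sum>j\<in>R. f i * of_int (dbl_gram leq i j) * g j)"
    using R g by (intro sum.cong refl sum.mono_neutral_right) auto
  also have "\<dots> = (\<Sum>a\<in>{1..m}. \<Sum>j\<in>R. f (e a) * of_int (dbl_gram leq (e a) j) * g j)"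
    by (rule sum.reindex_bij_betw[OF e, symmetric])
  also have "\<dots> = (\<Sum>a\<in>{1..m}. \<Sum>b\<in>{1..m}. f (e a) * of_int (dbl_gram leq (e a) (e b)) * g (e b))"
    by (intro sum.cong refl sum.reindex_bij_betw[OF e, symmetric])
  finally show ?thesis unfolding bform_def dbl_gram_def .
qed

lemma sorted_list_enum:
  assumes "finite R" "card R = m"
  shows "bij_betw (\<lambda>a. sorted_list_of_set R ! (a - 1)) {1..m} R"
proof -
  have "bij_betw (\<lambda>a. a - 1) {1..m} {..<m}"
    by (rule bij_betwI[where g = Suc]) auto
  moreover have "bij_betw ((!) (sorted_list_of_set R)) {..<m} R"
    using assms by (intro bij_betw_nth) auto
  ultimately show ?thesis using bij_betw_trans by (fastforce simp: comp_def)
qed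

lemma invertible_mat_of_inverse:
  assumes "B \<in> carrier_mat m m" "C \<in> carrier_mat m m" "C * B = 1\<^sub>m m" "B * C = 1\<^sub>m m"
  shows "invertible_mat B"
  using assms unfolding invertible_mat_def inverts_mat_def by auto

theorem oriented_path_type_A:
  assumes po: "is_poset n leq" and pa: "hasse_oriented_path n leq"
  shows "nonneg_crk n leq 0 \<and> dyn_is_A n leq n"
proof -
  interpret fin_poset n leq using po by unfold_locales
  obtain B C where B: "B \<in> carrier_mat n n" and C: "C \<in> carrier_mat n n"
    and inv: "C * B = 1\<^sub>m n" "B * C = 1\<^sub>m n"
    and G: "gram_mat n leq = transpose_mat (map_mat of_int B) * gram_A n * map_mat of_int B"
    using oriented_path_congruence[OF pa] by blast
  have pd: "posdef n (gram_mat n leq)" unfolding G by (rule gram_congruence_posdef[OF B C inv(1)])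
  have 1: "nonneg_crk n leq 0"
    unfolding nonneg_crk_def using posdef_rank[OF pd] posdef_imp_pos_semidef[OF pd] by simp
  have ker: "v $ t = 0" if "v \<in> kernel_q n leq" "t < n" for v t
  proof (rule ccontr)
    assume "v $ t \<noteq> 0"
    then have "0 < bform n leq (\<lambda>i. of_int (v $ (i - 1))) (\<lambda>i. of_int (v $ (i - 1)))"
      using that by (intro posdef_gram_mat_bform[OF pd, of "Suc t"]) auto
    then show False using that quad_form_bform[of v n leq] unfolding kernel_q_def by simp
  qed
  have e: "sorted_list_of_set {1..n} ! i = Suc i" if "i < n" for i
  proof -
    have "sorted_list_of_set {1..n} = [1..<Suc n]"
      by (metis atLeastLessThanSuc_atLeastAtMost sorted_list_of_set_range)
    then show ?thesis using that by (simp del: upt_Suc)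
  qed
  have "gram_mat n (\<lambda>a b. leq (sorted_list_of_set {1..n} ! (a - 1)) (sorted_list_of_set {1..n} ! (b - 1))) = gram_mat n leq"
    by (rule eq_matI) (auto simp: gram_mat_index dbl_gram_def e[simplified])
  \<comment> \<open>With nothing removed, \<open>k\<close> and \<open>h\<close> range over an empty
    index set, so \<open>id\<close> and \<open>undefined\<close> serve; the basis condition says
    that the kernel is trivial.\<close>
  then have 2: "dyn_is_A n leq n"
    unfolding dyn_is_A_def Let_def using ker B invertible_mat_of_inverse[OF B C inv] G
    by (intro exI[of _ 0] exI[of _ id] exI[of _ undefined] exI[of _ B]) (auto simp: strict_mono_on_def)
  show ?thesis using 1 2 ..
qed

section \<open>The kernel vector of a cycle and the removal of a sink\<close>

context hasse_cycle
begin

lemma sink_not_source: "x \<in> sinks \<Longrightarrow> x \<notin> sources"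
  using two[of x] unfolding sinks_iff sources_iff hasse_adj_def by blast

definition kvec :: "nat \<Rightarrow> int" where
  "kvec x = of_bool (x \<in> sinks) - of_bool (x \<in> sources)"

text \<open>The sum counts the sinks comparable with \<open>x\<close> against the sources. An
  element that is neither lies below one sink and above one source. A sink counts itself twice,
  against the two sources below it, and dually for a source.\<close>

lemma kvec_in_kernel:
  assumes s: "2 \<le> card sinks" and x: "x \<in> V"
  shows "(\<Sum>j\<in>V. dbl_gram leq x j * kvec j) = 0"
proof -
  have fin: "finite sinks" "finite sources" unfolding hasse_sinks_def by auto
  have count: "(\<Sum>j\<in>V. of_bool (P j) * of_bool (j \<in> S)) = int (card {j \<in> S. P j})" if "S \<subseteq> V" for P S
  proof -
    have "(\<Sum>j\<in>V. of_bool (P j) * of_bool (j \<in> S)) = (\<Sum>j\<in>V. if j \<in> {j \<in> S. P j} then 1 else (0::int))"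
      by (rule sum.cong) auto
    also have "\<dots> = (\<Sum>j\<in>{j \<in> S. P j}. 1)"
      using \<open>S \<subseteq> V\<close> by (subst sum.inter_restrict[symmetric]) (auto intro!: arg_cong[of _ _ card])
    finally show ?thesis by simp
  qed
  have sub: "sinks \<subseteq> V" "sources \<subseteq> V" using sinks_iff sources_iff by blast+
  have "(\<Sum>j\<in>V. dbl_gram leq x j * kvec j)
     = (\<Sum>j\<in>V. of_bool (leq x j) * of_bool (j \<in> sinks)) + (\<Sum>j\<in>V. of_bool (leq j x) * of_bool (j \<in> sinks))
     - ((\<Sum>j\<in>V. of_bool (leq x j) * of_bool (j \<in> sources)) + (\<Sum>j\<in>V. of_bool (leq j x) * of_bool (j \<in> sources)))"
    unfolding sum.distrib[symmetric] sum_subtractf[symmetric]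
    by (rule sum.cong) (auto simp: dbl_gram_def kvec_def algebra_simps)
  also have "\<dots> = int (card {j \<in> sinks. leq x j}) + int (card {j \<in> sinks. leq j x})
     - (int (card {j \<in> sources. leq x j}) + int (card {j \<in> sources. leq j x}))"
    unfolding count[OF sub(1)] count[OF sub(2)] ..
  also have "{j \<in> sinks. leq j x} = (if x \<in> sinks then {x} else {})"
    using sink_maximal[OF _ x] refl[OF x] by auto
  also have "{j \<in> sources. leq x j} = (if x \<in> sources then {x} else {})"
    using source_minimal[OF _ x] refl[OF x] by auto
  also have "card {j \<in> sinks. leq x j} = (if x \<in> sources then 2 else 1)"
    using two_sinks_above_source[OF s, of x] unique_sink_above[OF x] by simp
  also have "card {j \<in> sources. leq j x} = (if x \<in> sinks then 2 else 1)"
    using two_sources_below_sink[OF s, of x] hasse_cycle.unique_sink_above[OF dual_cycle x] by simp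
  finally show ?thesis using sink_not_source[of x] by (auto split: if_splits)
qed

text \<open>A sink never lies strictly between two elements, so its removal creates no new covers
  and the Hasse digraph of the subposet is the induced one: a cycle without one vertex.\<close>

lemma remove_sink_path:
  assumes k: "k \<in> sinks" and e: "bij_betw e {1..n - 1} (V - {k})"
  shows "is_poset (n - 1) (\<lambda>a b. leq (e a) (e b))"
    and "hasse_oriented_path (n - 1) (\<lambda>a b. leq (e a) (e b))"
proof -
  let ?leq = "\<lambda>a b. leq (e a) (e b)"
  have kV: "k \<in> V" using k sinks_iff by blast
  have eV: "e a \<in> V" "e a \<noteq> k" if "a \<in> {1..n - 1}" for a using bij_betwE[OF e] that by blast+
  have einj: "a = b" if "a \<in> {1..n - 1}" "b \<in> {1..n - 1}" "e a = e b" for a b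
    using e that unfolding bij_betw_def inj_on_def by blast
  have esur: "\<exists>a\<in>{1..n - 1}. e a = x" if "x \<in> V" "x \<noteq> k" for x
    using e that unfolding bij_betw_def by (metis (no_types, lifting) DiffI imageE singletonD)
  show "is_poset (n - 1) ?leq"
    unfolding is_poset_def
  proof (intro conjI ballI impI)
    fix a assume "a \<in> {1..n - 1}"
    then show "leq (e a) (e a)" using eV(1) refl by blast
  next
    fix a b assume ab: "a \<in> {1..n - 1}" "b \<in> {1..n - 1}" and l: "leq (e a) (e b) \<and> leq (e b) (e a)"
    have "e a = e b" by (rule antisym[OF eV(1)[OF ab(1)] eV(1)[OF ab(2)]]) (use l in auto)
    then show "a = b" using einj ab by blast
  next
    fix a b c assume abc: "a \<in> {1..n - 1}" "b \<in> {1..n - 1}" "c \<in> {1..n - 1}"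
      and l: "leq (e a) (e b) \<and> leq (e b) (e c)"
    show "leq (e a) (e c)"
      by (rule trans[OF eV(1)[OF abc(1)] eV(1)[OF abc(2)] eV(1)[OF abc(3)]]) (use l in auto)
  qed
  have ar: "hasse_arrow (n - 1) ?leq a b \<longleftrightarrow> arr (e a) (e b)" if ab: "a \<in> {1..n - 1}" "b \<in> {1..n - 1}" for a b
  proof
    assume h: "hasse_arrow (n - 1) ?leq a b"
    have "\<not> (\<exists>l\<in>V. l \<noteq> e a \<and> l \<noteq> e b \<and> leq (e a) l \<and> leq l (e b))"
    proof
      assume "\<exists>l\<in>V. l \<noteq> e a \<and> l \<noteq> e b \<and> leq (e a) l \<and> leq l (e b)"
      then obtain l where l: "l \<in> V" "l \<noteq> e a" "l \<noteq> e b" "leq (e a) l" "leq l (e b)" by blast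
      have "l \<noteq> k" using sink_maximal[OF k, of "e b"] eV[OF ab(2)] l by blast
      then obtain c where c: "c \<in> {1..n - 1}" "e c = l" using esur l by blast
      have "c \<noteq> a" "c \<noteq> b" using c l by auto
      then show False using h l(4,5) c(1) unfolding hasse_arrow_def c(2)[symmetric] by blast
    qed
    then show "arr (e a) (e b)" using h ab eV einj unfolding hasse_arrow_def by blast
  next
    assume "arr (e a) (e b)"
    then show "hasse_arrow (n - 1) ?leq a b" using ab eV einj unfolding hasse_arrow_def by blast
  qed
  have ad: "hasse_adj (n - 1) ?leq a b \<longleftrightarrow> adj (e a) (e b)" if ab: "a \<in> {1..n - 1}" "b \<in> {1..n - 1}" for a b
    unfolding hasse_adj_def using ar[OF ab] ar[OF ab(2,1)] by simp
  interpret degree_le_2_graph V adj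
    by unfold_locales (use kV adj_sym adjD(2) adjD(4) deg conn in \<open>blast | metis finite_atLeastAtMost\<close>)+
  obtain xs where xs: "distinct xs" "set xs = V - {k}"
    "\<And>a b. a < length xs \<Longrightarrow> b < length xs \<Longrightarrow> adj (xs ! a) (xs ! b) \<longleftrightarrow> a + 1 = b \<or> b + 1 = a"
    using cycle_minus_vertex[OF kV two] by blast
  have len: "length xs = n - 1" using xs(1,2) kV distinct_card[of xs] by simp
  define p where "p a = inv_into {1..n - 1} e (xs ! a)" for a
  have "bij_betw ((!) xs) {0..<n - 1} (V - {k})" using xs len by (intro bij_betw_nth) auto
  then have "bij_betw p {0..<n - 1} {1..n - 1}"
    using bij_betw_trans[OF _ bij_betw_inv_into[OF e]] by (simp add: p_def[abs_def] comp_def)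
  moreover have "e (p a) = xs ! a" "p a \<in> {1..n - 1}" if "a < n - 1" for a
  proof -
    have "xs ! a \<in> e ` {1..n - 1}" using xs(2) len that e unfolding bij_betw_def by (metis nth_mem)
    then show "e (p a) = xs ! a" "p a \<in> {1..n - 1}" unfolding p_def by (rule f_inv_into_f, rule inv_into_into)
  qed
  ultimately show "hasse_oriented_path (n - 1) ?leq"
    unfolding hasse_oriented_path_def using ad xs(3) len by (intro exI[of _ p]) simp
qed

text \<open>The removed index is a sink \<open>k\<close>, where the kernel vector has the entry 1
  that the definition of the type demands.\<close>

theorem cycle_type_A:
  assumes s: "2 \<le> card sinks"
  shows "nonneg_crk n leq 1 \<and> dyn_is_A n leq (n - 1)"
proof -
  have "sinks \<noteq> {}" using s by auto
  then obtain k where k: "k \<in> sinks" by blast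
  then have kV: "k \<in> V" using sinks_iff by blast
  define e where "e a = sorted_list_of_set (V - {k}) ! (a - 1)" for a
  let ?leq = "\<lambda>a b. leq (e a) (e b)"
  have e: "bij_betw e {1..n - 1} (V - {k})"
    unfolding e_def[abs_def] using kV by (intro sorted_list_enum) auto
  interpret I: fin_poset "n - 1" ?leq using remove_sink_path(1)[OF k e] by unfold_locales
  obtain B C where B: "B \<in> carrier_mat (n - 1) (n - 1)" and C: "C \<in> carrier_mat (n - 1) (n - 1)"
    and inv: "C * B = 1\<^sub>m (n - 1)" "B * C = 1\<^sub>m (n - 1)"
    and G: "gram_mat (n - 1) ?leq = transpose_mat (map_mat of_int B) * gram_A (n - 1) * map_mat of_int B"
    using I.oriented_path_congruence[OF remove_sink_path(2)[OF k e]] by blast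
  have pd: "posdef (n - 1) (gram_mat (n - 1) ?leq)" unfolding G by (rule gram_congruence_posdef[OF B C inv(1)])
  let ?h = "\<lambda>i. of_int (kvec i) :: real"
  have hk: "kvec k = 1" using k sink_not_source unfolding kvec_def by simp
  have bh: "bform n leq f ?h = 0" for f
  proof -
    have "bform n leq f ?h = (\<Sum>i\<in>V. f i * of_int (\<Sum>j\<in>V. dbl_gram leq i j * kvec j))"
      unfolding bform_def of_int_sum sum_distrib_left by (simp add: mult_ac)
    also have "\<dots> = (\<Sum>i\<in>V. 0)"
      by (rule sum.cong[OF HOL.refl]) (simp only: kvec_in_kernel[OF s] of_int_0 mult_zero_right)
    finally show ?thesis by simp
  qed
  \<comment> \<open>Subtracting \<open>f k\<close> times the kernel vector kills the coordinate at
    \<open>k\<close> without changing the form, so everything is decided on the subposet without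
    \<open>k\<close>, where the form is positive definite.\<close>
  have red: "bform n leq f f = bform n leq (\<lambda>i. f i + (- f k) * ?h i) (\<lambda>i. f i + (- f k) * ?h i)" for f
    unfolding bform_add_left bform_add_right bh bform_sym[of n leq ?h] by simp
  have red': "bform n leq f f = bform (n - 1) ?leq (\<lambda>a. f (e a) + (- f k) * ?h (e a)) (\<lambda>a. f (e a) + (- f k) * ?h (e a))" for f
    unfolding red[of f] by (rule bform_restrict[OF e]) (use hk in auto)
  have nonneg: "0 \<le> bform n leq f f" for f
    unfolding red' using posdef_imp_pos_semidef[OF pd] pos_semidef_gram_mat by simp
  have zero: "f i = f k * ?h i" if z: "bform n leq f f = 0" and i: "i \<in> V" for f i
  proof (cases "i = k")
    case True
    then show ?thesis using hk by simp
  next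
    case False
    then have "i \<in> e ` {1..n - 1}" using i e unfolding bij_betw_def by blast
    then obtain a where a: "a \<in> {1..n - 1}" "i = e a" by blast
    show ?thesis
    proof (rule ccontr)
      assume "f i \<noteq> f k * ?h i"
      then have "0 < bform (n - 1) ?leq (\<lambda>a. f (e a) + (- f k) * ?h (e a)) (\<lambda>a. f (e a) + (- f k) * ?h (e a))"
        using a by (intro posdef_gram_mat_bform[OF pd]) auto
      then show False using z red' by simp
    qed
  qed
  define hv where "hv = vec n (\<lambda>i. kvec (Suc i))"
  have hvc: "hv \<in> carrier_vec n" unfolding hv_def by simp
  have hvi: "hv $ (i - 1) = kvec i" if "i \<in> V" for i using that unfolding hv_def by auto
  have hv0: "bform n leq (\<lambda>i. of_int (hv $ (i - 1))) (\<lambda>i. of_int (hv $ (i - 1))) = 0"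
  proof -
    have "bform n leq (\<lambda>i. of_int (hv $ (i - 1))) (\<lambda>i. of_int (hv $ (i - 1))) = bform n leq ?h ?h"
      by (rule bform_cong) (use hvi in auto)
    then show ?thesis using bh by simp
  qed
  have hker: "hv \<in> kernel_q n leq"
    unfolding kernel_q_def using hvc quad_form_bform[OF hvc, of leq] hv0 by simp
  \<comment> \<open>The factor is the entry of \<open>v\<close> at \<open>k\<close>, an integer, so
    \<open>hv\<close> generates the kernel over the integers.\<close>
  have ker: "v $ t = v $ (k - 1) * hv $ t" if v: "v \<in> kernel_q n leq" and t: "t < n" for v t
  proof -
    have "v \<in> carrier_vec n" "quad_form n leq v = 0" using v unfolding kernel_q_def by auto
    then have "bform n leq (\<lambda>i. of_int (v $ (i - 1))) (\<lambda>i. of_int (v $ (i - 1))) = 0"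
      using quad_form_bform[of v n leq] by simp
    from zero[OF this, of "Suc t"] have "real_of_int (v $ t) = of_int (v $ (k - 1) * kvec (Suc t))"
      using t by simp
    then have "v $ t = v $ (k - 1) * kvec (Suc t)" using of_int_eq_iff by blast
    then show ?thesis using t unfolding hv_def by simp
  qed
  have dyn: "dyn_is_A n leq (n - 1)"
    unfolding dyn_is_A_def Let_def
  proof (intro exI conjI)
    show "strict_mono_on {1..1::nat} (\<lambda>_. k)" by (auto simp: strict_mono_on_def)
    show "(\<lambda>_. k) ` {1..1::nat} \<subseteq> {1..n}" using kV by auto
    show "\<forall>i\<in>{1..1::nat}. (\<lambda>_. hv) i \<in> kernel_q n leq" using hker by simp
    show "\<forall>i\<in>{1..1::nat}. \<forall>j\<in>{1..1::nat}. (\<lambda>_. hv) i $ ((\<lambda>_. k) j - 1) = (if i = j then 1 else 0)"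
      using hvi[OF kV] hk by simp
    show "\<forall>v\<in>kernel_q n leq. \<exists>c. \<forall>t<n. v $ t = (\<Sum>i\<in>{1..1::nat}. c i * (\<lambda>_. hv) i $ t)"
    proof
      fix v assume "v \<in> kernel_q n leq"
      then show "\<exists>c. \<forall>t<n. v $ t = (\<Sum>i\<in>{1..1::nat}. c i * (\<lambda>_. hv) i $ t)"
        using ker by (intro exI[of _ "\<lambda>_. v $ (k - 1)"]) simp
    qed
    show "\<forall>c. (\<forall>t<n. (\<Sum>i\<in>{1..1::nat}. c i * (\<lambda>_. hv) i $ t) = 0) \<longrightarrow> (\<forall>i\<in>{1..1::nat}. c i = (0::int))"
    proof (intro allI impI ballI)
      fix c :: "nat \<Rightarrow> int" and i :: nat
      assume z: "\<forall>t<n. (\<Sum>i\<in>{1..1::nat}. c i * (\<lambda>_. hv) i $ t) = 0" and i: "i \<in> {1..1}"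
      have "k - 1 < n" using kV by auto
      then have "c 1 * hv $ (k - 1) = 0" using z by fastforce
      then show "c i = 0" using hvi[OF kV] hk i by simp
    qed
    show "n - 1 = n - 1" ..
    show "B \<in> carrier_mat (n - 1) (n - 1)" by (rule B)
    show "invertible_mat B" by (rule invertible_mat_of_inverse[OF B C inv])
    have "V - (\<lambda>_. k) ` {1..1::nat} = V - {k}" by auto
    then show "gram_mat (n - 1) (\<lambda>a b. leq (sorted_list_of_set (V - (\<lambda>_. k) ` {1..1::nat}) ! (a - 1))
         (sorted_list_of_set (V - (\<lambda>_. k) ` {1..1::nat}) ! (b - 1)))
       = transpose_mat (map_mat of_int B) * gram_A (n - 1) * map_mat of_int B"
      using G unfolding e_def by simp
  qed
  have rk1: "vec_space.rank n (gram_mat n leq) \<noteq> n"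
  proof -
    have "gram_mat n leq *\<^sub>v map_vec of_int hv = 0\<^sub>v n"
    proof (rule eq_vecI)
      fix i assume "i < dim_vec (0\<^sub>v n :: real vec)"
      then have i: "i < n" by simp
      have "(\<Sum>j\<in>V. of_int (dbl_gram leq (Suc i) j) * map_vec of_int hv $ (j - 1) :: real)
          = of_int (\<Sum>j\<in>V. dbl_gram leq (Suc i) j * kvec j)"
        unfolding of_int_sum using hvi hvc by (intro sum.cong) auto
      also have "\<dots> = 0" using kvec_in_kernel[OF s, of "Suc i"] i by simp
      finally show "(gram_mat n leq *\<^sub>v map_vec of_int hv) $ i = 0\<^sub>v n $ i"
        using gram_mat_mult_index[of "map_vec of_int hv" n i leq] hvc i by simp
    qed simp
    moreover have "map_vec real_of_int hv \<noteq> 0\<^sub>v n"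
    proof
      assume "map_vec real_of_int hv = 0\<^sub>v n"
      then have "map_vec real_of_int hv $ (k - 1) = 0" using kV by auto
      then show False using hvi[OF kV] hk hvc kV by auto
    qed
    ultimately have "det (gram_mat n leq) = 0"
      using hvc det_0_iff_vec_prod_zero[OF gram_mat_carrier] by (metis map_carrier_vec)
    then show ?thesis using vec_space.det_rank_iff[OF gram_mat_carrier] by blast
  qed
  \<comment> \<open>\<open>E\<close> adds the square of the coordinate at \<open>k\<close>. A null
    vector of the form is a multiple of \<open>kvec\<close>, which is 1 at \<open>k\<close>, so the
    sum is definite. As \<open>E\<close> has rank at most 1, the Gram matrix has rank at least
    \<open>n - 1\<close>.\<close>
  define E :: "real mat" where "E = mat n n (\<lambda>(i, j). of_bool (i = k - 1) * of_bool (j = k - 1))"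
  have E: "E \<in> carrier_mat n n" unfolding E_def by simp
  have "posdef n (gram_mat n leq + E)"
    unfolding posdef_def
  proof (intro ballI impI)
    fix x :: "real vec" assume x: "x \<in> carrier_vec n" and x0: "x \<noteq> 0\<^sub>v n"
    let ?f = "\<lambda>i. x $ (i - 1)"
    have "E *\<^sub>v x = vec n (\<lambda>i. of_bool (i = k - 1) * x $ (k - 1))"
    proof (rule eq_vecI)
      fix i assume "i < dim_vec (vec n (\<lambda>i. of_bool (i = k - 1) * x $ (k - 1)))"
      then have i: "i < n" by simp
      have "(E *\<^sub>v x) $ i = (\<Sum>j<n. of_bool (i = k - 1) * of_bool (j = k - 1) * x $ j)"
        using i x unfolding E_def by (auto simp: scalar_prod_def lessThan_atLeast0 intro!: sum.cong)
      also have "\<dots> = (\<Sum>j<n. if j = k - 1 then of_bool (i = k - 1) * x $ (k - 1) else 0)"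
        by (rule sum.cong) auto
      also have "\<dots> = of_bool (i = k - 1) * x $ (k - 1)" using kV by auto
      finally show "(E *\<^sub>v x) $ i = vec n (\<lambda>i. of_bool (i = k - 1) * x $ (k - 1)) $ i" using i by simp
    qed (simp add: E_def)
    then have "x \<bullet> (E *\<^sub>v x) = (\<Sum>i<n. x $ i * (of_bool (i = k - 1) * x $ (k - 1)))"
      by (simp add: scalar_prod_def lessThan_atLeast0)
    also have "\<dots> = (\<Sum>i<n. if i = k - 1 then x $ (k - 1) * x $ (k - 1) else 0)"
      by (rule sum.cong) auto
    also have "\<dots> = ?f k * ?f k" using kV by auto
    finally have xE: "x \<bullet> (E *\<^sub>v x) = ?f k * ?f k" .
    have "x \<bullet> ((gram_mat n leq + E) *\<^sub>v x) = x \<bullet> (gram_mat n leq *\<^sub>v x) + x \<bullet> (E *\<^sub>v x)"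
      using add_mult_distrib_mat_vec[OF gram_mat_carrier E x]
        scalar_prod_add_distrib[OF x, of "gram_mat n leq *\<^sub>v x" "E *\<^sub>v x"] E x
      by (simp add: mult_mat_vec_carrier[OF gram_mat_carrier] mult_mat_vec_carrier[OF E])
    then have eq: "x \<bullet> ((gram_mat n leq + E) *\<^sub>v x) = bform n leq ?f ?f / 2 + ?f k * ?f k"
      unfolding xE gram_mat_bform[OF x x] .
    show "0 < x \<bullet> ((gram_mat n leq + E) *\<^sub>v x)"
    proof (rule ccontr)
      assume "\<not> 0 < x \<bullet> ((gram_mat n leq + E) *\<^sub>v x)"
      moreover have "0 \<le> ?f k * ?f k" by simp
      ultimately have z: "bform n leq ?f ?f = 0" "?f k * ?f k = 0" using nonneg[of ?f] eq by linarith+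
      have "x $ t = 0" if "t < n" for t using zero[OF z(1), of "Suc t"] z(2) that by simp
      then have "x = 0\<^sub>v n" using x by (intro eq_vecI) auto
      then show False using x0 by simp
    qed
  qed
  then have "vec_space.rank n (gram_mat n leq + E) = n" using E by (intro posdef_rank) auto
  moreover have "vec_space.rank n (gram_mat n leq + E) \<le> vec_space.rank n (gram_mat n leq) + vec_space.rank n E"
    by (rule vec_space.rank_subadditive[OF gram_mat_carrier E])
  moreover have "vec_space.rank n E \<le> 1"
    by (rule vec_space.rank_le_1_product_entries[OF E, of "\<lambda>i. of_bool (i = k - 1)" "\<lambda>i. of_bool (i = k - 1)"])
      (auto simp: E_def)
  moreover have "vec_space.rank n (gram_mat n leq) \<le> n"
    by (rule vec_space.rank_le_nc[OF gram_mat_carrier])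
  ultimately have "vec_space.rank n (gram_mat n leq) = n - 1" using rk1 by linarith
  then have "nonneg_crk n leq 1"
    unfolding nonneg_crk_def pos_semidef_gram_mat using nonneg kV by simp
  then show ?thesis using dyn ..
qed

end

section \<open>Posets of type A\<close>

text \<open>Along the isotropic direction \<open>h\<close> the form at \<open>f + c h\<close> is
  linear in \<open>c\<close>, and a linear function bounded below is constant.\<close>

lemma bform_null:
  assumes psd: "\<And>f. 0 \<le> bform n leq f f" and h: "bform n leq h h = 0"
  shows "bform n leq f h = 0"
proof (rule ccontr)
  assume nz: "bform n leq f h \<noteq> 0"
  define b q where "b = bform n leq f h" and "q = bform n leq f f"
  have "bform n leq (\<lambda>i. f i + c * h i) (\<lambda>i. f i + c * h i) = q + 2 * c * b" for c
    unfolding bform_add_left bform_add_right h bform_sym[of n leq h f] b_def q_def by simp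
  then have "0 \<le> q + 2 * c * b" for c using psd by metis
  \<comment> \<open>For this \<open>c\<close> the value \<open>q + 2 * c * b\<close> is -1.\<close>
  from this[of "- (q + 1) / (2 * b)"] show False using nz unfolding b_def[symmetric] by (simp add: field_simps)
qed

text \<open>Modulo kernel vectors, which are orthogonal to everything by semidefiniteness, each
  element is an integer combination of the kept elements. The same combination of the columns of
  \<open>root_mat m * B\<close> is its vector; coordinate sums vanish as they do for simple
  roots.\<close>

lemma type_A_vectors:
  assumes psd: "pos_semidef n (gram_mat n leq)" and dyn: "dyn_is_A n leq m"
  shows "\<exists>w :: nat \<Rightarrow> nat \<Rightarrow> int. (\<forall>i\<in>{1..n}. \<forall>j\<in>{1..n}. (\<Sum>l<Suc m. w i l * w j l) = dbl_gram leq i j)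
    \<and> (\<forall>i\<in>{1..n}. (\<Sum>l<Suc m. w i l) = 0)"
proof -
  obtain r k h and B :: "int mat" where
      kmono: "strict_mono_on {1..r::nat} k" and kn: "k ` {1..r} \<subseteq> {1..n}"
    and hker: "\<forall>i\<in>{1..r}. h i \<in> kernel_q n leq"
    and hk: "\<forall>i\<in>{1..r}. \<forall>j\<in>{1..r}. h i $ (k j - 1) = (if i = j then 1 else 0)"
    and m: "m = n - r" and B: "B \<in> carrier_mat m m"
    and G: "gram_mat m (\<lambda>a b. leq (sorted_list_of_set ({1..n} - k ` {1..r}) ! (a - 1))
        (sorted_list_of_set ({1..n} - k ` {1..r}) ! (b - 1)))
      = transpose_mat (map_mat of_int B) * gram_A m * map_mat of_int B"
    using dyn unfolding dyn_is_A_def Let_def by blast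
  define K where "K = k ` {1..r}"
  define R where "R = {1..n} - K"
  define e where "e a = sorted_list_of_set R ! (a - 1)" for a
  have kinj: "inj_on k {1..r}" using kmono by (rule strict_mono_on_imp_inj_on)
  have "card K = r" unfolding K_def using card_image[OF kinj] by simp
  then have "card R = m" unfolding R_def m using kn by (simp add: K_def card_Diff_subset finite_subset)
  then have e: "bij_betw e {1..m} R" unfolding e_def[abs_def] by (intro sorted_list_enum) (auto simp: R_def)
  define W where "W = root_mat m * B"
  have W: "W \<in> carrier_mat (Suc m) m" unfolding W_def by (rule mult_carrier_mat[OF root_mat_carrier B])
  have WW: "(\<Sum>l<Suc m. W $$ (l, a - 1) * W $$ (l, b - 1)) = dbl_gram leq (e a) (e b)"
    if ab: "a \<in> {1..m}" "b \<in> {1..m}" for a b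
  proof -
    let ?leq = "\<lambda>a b. leq (e a) (e b)"
    have i: "a - 1 < m" "b - 1 < m" using ab by auto
    have "gram_mat m ?leq = transpose_mat (map_mat of_int B) * gram_A m * map_mat of_int B"
      using G unfolding e_def R_def K_def .
    also have "\<dots> = (1/2) \<cdot>\<^sub>m (transpose_mat (map_mat of_int W) * map_mat of_int W)"
      unfolding gram_A_congruence[OF B] W_def ..
    finally have "real_of_int (dbl_gram ?leq (Suc (a - 1)) (Suc (b - 1))) / 2
        = of_int (\<Sum>l<Suc m. W $$ (l, a - 1) * W $$ (l, b - 1)) / 2"
      using half_gram_index[OF W i] gram_mat_index[OF i, of ?leq] by simp
    then have "dbl_gram ?leq (Suc (a - 1)) (Suc (b - 1)) = (\<Sum>l<Suc m. W $$ (l, a - 1) * W $$ (l, b - 1))"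
      by linarith
    moreover have "Suc (a - 1) = a" "Suc (b - 1) = b" using ab by auto
    ultimately show ?thesis by (simp add: dbl_gram_def)
  qed
  have W0: "(\<Sum>l<Suc m. W $$ (l, a)) = 0" if a: "a < m" for a
  proof -
    have "(\<Sum>l<Suc m. W $$ (l, a)) = (\<Sum>l<Suc m. \<Sum>j<m. simple_root l j * B $$ (j, a))"
      using a B unfolding W_def root_mat_def
      by (intro sum.cong) (auto simp: scalar_prod_def lessThan_atLeast0 intro!: sum.cong)
    also have "\<dots> = (\<Sum>j<m. (\<Sum>l<Suc m. simple_root l j) * B $$ (j, a))"
      unfolding sum_distrib_right by (rule sum.swap)
    also have "\<dots> = 0"
    proof (rule sum.neutral, rule ballI)
      fix j assume "j \<in> {..<m}"
      then have "(\<Sum>l<Suc m. simple_root l j :: int) = (\<Sum>l<Suc m. if l = j then 1 else 0) - (\<Sum>l<Suc m. if l = Suc j then 1 else 0)"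
        unfolding sum_subtractf[symmetric] by (intro sum.cong) (auto simp: simple_root_def)
      also have "\<dots> = 0" using \<open>j \<in> {..<m}\<close> by simp
      finally show "(\<Sum>l<Suc m. simple_root l j) * B $$ (j, a) = 0" by simp
    qed
    finally show ?thesis .
  qed
  \<comment> \<open>For a removed index, \<open>g i\<close> is the basis vector of the kernel that
    belongs to it. The delta condition on the basis makes \<open>red i\<close> vanish at all removed
    indices.\<close>
  define g where "g i s = (if i \<in> K then h (inv_into {1..r} k i) $ (s - 1) else 0)" for i s
  define red where "red i s = of_bool (s = i) - g i s" for i s
  have bg: "bform n leq f (\<lambda>s. of_int (g i s)) = 0" for f i
  proof (cases "i \<in> K")
    case True
    then have "inv_into {1..r} k i \<in> {1..r}" unfolding K_def by (rule inv_into_into)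
    then have "h (inv_into {1..r} k i) \<in> kernel_q n leq" using hker by blast
    then have null: "bform n leq (\<lambda>s. of_int (g i s)) (\<lambda>s. of_int (g i s)) = 0"
      using quad_form_bform[of "h (inv_into {1..r} k i)" n leq] True unfolding kernel_q_def g_def by simp
    have "0 \<le> bform n leq f f" for f using psd unfolding pos_semidef_gram_mat by blast
    from bform_null[OF this null] show ?thesis .
  next
    case False
    then show ?thesis by (simp add: g_def bform_def)
  qed
  have red0: "red i s = 0" if s: "s \<in> {1..n} - R" for i s
  proof -
    obtain t where t: "t \<in> {1..r}" "s = k t" using s unfolding R_def K_def by blast
    show ?thesis
    proof (cases "i \<in> K")
      case True
      then obtain j where j: "j \<in> {1..r}" "i = k j" unfolding K_def by blast
      have "inv_into {1..r} k i = j" using j kinj by simp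
      moreover have "k t = k j \<longleftrightarrow> j = t" using inj_on_eq_iff[OF kinj t(1) j(1)] by auto
      ultimately show ?thesis using True hk j t unfolding red_def g_def by simp
    next
      case False
      then have "s \<noteq> i" using t unfolding K_def by blast
      then show ?thesis using False unfolding red_def g_def by simp
    qed
  qed
  have delta: "bform n leq (\<lambda>s. of_bool (s = i)) (\<lambda>s. of_bool (s = j)) = of_int (dbl_gram leq i j)"
    if ij: "i \<in> {1..n}" "j \<in> {1..n}" for i j
  proof -
    have "bform n leq (\<lambda>s. of_bool (s = i)) (\<lambda>s. of_bool (s = j))
        = (\<Sum>s\<in>{1..n}. \<Sum>t\<in>{1..n}. if t = j then (if s = i then of_int (dbl_gram leq i j) else 0) else 0)"
      unfolding bform_def by (intro sum.cong) auto
    then show ?thesis using ij by simp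
  qed
  have bred: "bform n leq (\<lambda>s. of_int (red i s)) (\<lambda>s. of_int (red j s)) = of_int (dbl_gram leq i j)"
    if ij: "i \<in> {1..n}" "j \<in> {1..n}" for i j
  proof -
    have *: "(\<lambda>s. of_int (red i s)) = (\<lambda>s. of_bool (s = i) + (- 1) * real_of_int (g i s))" for i
      unfolding red_def by auto
    show ?thesis unfolding * bform_add_left bform_add_right bg bform_sym[of n leq "\<lambda>s. real_of_int (g i s)"]
      using delta[OF ij] by simp
  qed
  define w where "w i l = (\<Sum>a\<in>{1..m}. red i (e a) * W $$ (l, a - 1))" for i l
  have "(\<Sum>l<Suc m. w i l * w j l) = dbl_gram leq i j" if ij: "i \<in> {1..n}" "j \<in> {1..n}" for i j
  proof -
    have "(\<Sum>l<Suc m. w i l * w j l)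
       = (\<Sum>l<Suc m. \<Sum>a\<in>{1..m}. \<Sum>b\<in>{1..m}. red i (e a) * (W $$ (l, a - 1) * W $$ (l, b - 1)) * red j (e b))"
      unfolding w_def sum_product by (intro sum.cong) (auto simp: mult_ac)
    also have "\<dots> = (\<Sum>a\<in>{1..m}. \<Sum>l<Suc m. \<Sum>b\<in>{1..m}. red i (e a) * (W $$ (l, a - 1) * W $$ (l, b - 1)) * red j (e b))"
      by (rule sum.swap)
    also have "\<dots> = (\<Sum>a\<in>{1..m}. \<Sum>b\<in>{1..m}. \<Sum>l<Suc m. red i (e a) * (W $$ (l, a - 1) * W $$ (l, b - 1)) * red j (e b))"
      by (intro sum.cong refl sum.swap)
    also have "\<dots> = (\<Sum>a\<in>{1..m}. \<Sum>b\<in>{1..m}. red i (e a) * dbl_gram leq (e a) (e b) * red j (e b))"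
      unfolding sum_distrib_left[symmetric] sum_distrib_right[symmetric] by (intro sum.cong refl) (simp only: WW)
    finally have "real_of_int (\<Sum>l<Suc m. w i l * w j l)
        = bform m (\<lambda>a b. leq (e a) (e b)) (\<lambda>a. of_int (red i (e a))) (\<lambda>a. of_int (red j (e a)))"
      by (simp add: bform_def dbl_gram_def)
    also have "\<dots> = bform n leq (\<lambda>s. of_int (red i s)) (\<lambda>s. of_int (red j s))"
      by (rule bform_restrict[OF e, symmetric]) (use red0 in \<open>auto simp: R_def\<close>)
    also have "\<dots> = of_int (dbl_gram leq i j)" by (rule bred[OF ij])
    finally show ?thesis by (simp only: of_int_eq_iff)
  qed
  moreover have "(\<Sum>l<Suc m. w i l) = 0" for i
  proof -
    have "(\<Sum>l<Suc m. w i l) = (\<Sum>a\<in>{1..m}. red i (e a) * (\<Sum>l<Suc m. W $$ (l, a - 1)))"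
      unfolding w_def sum_distrib_left by (rule sum.swap)
    also have "\<dots> = 0"
    proof (rule sum.neutral, rule ballI)
      fix a assume "a \<in> {1..m}"
      then have "a - 1 < m" by auto
      from W0[OF this] show "red i (e a) * (\<Sum>l<Suc m. W $$ (l, a - 1)) = 0" by simp
    qed
    finally show ?thesis .
  qed
  ultimately show ?thesis by blast
qed

text \<open>A nonzero vector with sum 0 has a positive and a negative entry. Being integers, their
  squares already exhaust the norm 2.\<close>

lemma norm_2_sum_0_shape:
  fixes f :: "nat \<Rightarrow> int"
  assumes s: "(\<Sum>l<N. f l) = 0" and q: "(\<Sum>l<N. f l * f l) = 2"
  shows "\<exists>a<N. \<exists>b<N. a \<noteq> b \<and> (\<forall>l<N. f l = of_bool (l = a) - of_bool (l = b))"
proof -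
  have ex: "\<exists>a<N. 0 < g a" if g: "(\<Sum>l<N. g l) = 0" "(\<Sum>l<N. g l * g l) = 2" for g :: "nat \<Rightarrow> int"
  proof (rule ccontr)
    assume "\<not> ?thesis"
    then have le: "\<forall>l\<in>{..<N}. 0 \<le> - g l" by auto
    have "(\<Sum>l<N. - g l) = 0" using g(1) by (simp add: sum_negf)
    then have "\<forall>l\<in>{..<N}. - g l = 0" using le by (subst (asm) sum_nonneg_eq_0_iff) auto
    then have "(\<Sum>l<N. g l * g l) = 0" by simp
    then show False using g(2) by simp
  qed
  obtain a where a: "a < N" "0 < f a" using ex[OF s q] by blast
  obtain b where b: "b < N" "f b < 0" using ex[of "\<lambda>l. - f l"] s q by (auto simp: sum_negf)
  have ab: "a \<noteq> b" using a b by auto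
  let ?R = "{..<N} - {a} - {b}"
  have split: "(\<Sum>l<N. g l) = g a + (g b + (\<Sum>l\<in>?R. g l))" for g :: "nat \<Rightarrow> int"
    using a b ab by (simp add: sum.remove[of "{..<N}" a] sum.remove[of "{..<N} - {a}" b])
  have R: "0 \<le> (\<Sum>l\<in>?R. f l * f l)" by (rule sum_nonneg) simp
  have "1 * 1 \<le> f a * f a" by (rule mult_mono) (use a in auto)
  moreover have "1 * 1 \<le> (- f b) * (- f b)" by (rule mult_mono) (use b in auto)
  ultimately have e: "f a * f a = 1" "f b * f b = 1" "(\<Sum>l\<in>?R. f l * f l) = 0"
    using q R unfolding split[of "\<lambda>l. f l * f l"] by auto
  have "f l = 0" if "l \<in> ?R" for l
    using e(3) that by (subst (asm) sum_nonneg_eq_0_iff) auto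
  moreover have "f a = 1" "f b = - 1" using e a b by (auto simp: zmult_eq_1_iff)
  ultimately have "\<forall>l<N. f l = of_bool (l = a) - of_bool (l = b)" using ab by auto
  then show ?thesis using a b ab by blast
qed

section \<open>From roots to the shape of the Hasse digraph\<close>

context fin_poset
begin

text \<open>Type \<open>A\<close> realises the elements by roots \<open>e\<^sub>s - e\<^sub>t\<close>. Two distinct ones have inner product 0 or 1,
  so comparability of \<open>i\<close> and \<open>j\<close> means \<open>s i = s j\<close> or \<open>t i = t j\<close>, but not both: the comparability
  graph is a line graph.\<close>

lemma type_A_line_graph:
  assumes "pos_semidef n (gram_mat n leq)" and "dyn_is_A n leq m"
  shows "\<exists>(s :: nat \<Rightarrow> nat) (t :: nat \<Rightarrow> nat). \<forall>i\<in>V. \<forall>j\<in>V.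
    (cmp i j \<longleftrightarrow> s i = s j \<or> t i = t j) \<and> (s i = s j \<and> t i = t j \<longrightarrow> i = j)"
proof -
  obtain w :: "nat \<Rightarrow> nat \<Rightarrow> int" where
      ww: "\<And>i j. i \<in> V \<Longrightarrow> j \<in> V \<Longrightarrow> (\<Sum>l<Suc m. w i l * w j l) = dbl_gram leq i j"
    and w0: "\<And>i. i \<in> V \<Longrightarrow> (\<Sum>l<Suc m. w i l) = 0"
    using type_A_vectors[OF assms] by blast
  have "\<forall>i\<in>V. \<exists>a b. a < Suc m \<and> b < Suc m \<and> a \<noteq> b \<and> (\<forall>l<Suc m. w i l = of_bool (l = a) - of_bool (l = b))"
  proof
    fix i assume i: "i \<in> V"
    have "(\<Sum>l<Suc m. w i l * w i l) = 2" using ww[OF i i] refl[OF i] by (simp add: dbl_gram_def)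
    from norm_2_sum_0_shape[OF w0[OF i] this]
    show "\<exists>a b. a < Suc m \<and> b < Suc m \<and> a \<noteq> b \<and> (\<forall>l<Suc m. w i l = of_bool (l = a) - of_bool (l = b))" by blast
  qed
  then obtain s t where st: "\<And>i. i \<in> V \<Longrightarrow> s i < Suc m \<and> t i < Suc m \<and> s i \<noteq> t i \<and>
      (\<forall>l<Suc m. w i l = of_bool (l = s i) - of_bool (l = t i))"
    by metis
  have prod: "dbl_gram leq i j = of_bool (s i = s j) + of_bool (t i = t j) - of_bool (s i = t j) - of_bool (t i = s j)"
    if ij: "i \<in> V" "j \<in> V" for i j
  proof -
    have "dbl_gram leq i j = (\<Sum>l<Suc m. w i l * w j l)" using ww[OF ij] by simp
    also have "\<dots> = (\<Sum>l<Suc m. (if l = s i then of_bool (s i = s j) - of_bool (s i = t j) else 0)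
        + (if l = t i then of_bool (t i = t j) - of_bool (t i = s j) else 0))"
      using st[OF ij(1)] st[OF ij(2)] by (intro sum.cong) auto
    also have "\<dots> = of_bool (s i = s j) - of_bool (s i = t j) + (of_bool (t i = t j) - of_bool (t i = s j))"
      unfolding sum.distrib using st[OF ij(1)] by simp
    finally show ?thesis by simp
  qed
  \<comment> \<open>If the head of one root were the tail of the other, both positive terms would
    vanish, since the two ends of a root differ, and the entry would be negative. If both ends agree
    the entry is 2, and antisymmetry gives equality.\<close>
  have *: "\<forall>i\<in>V. \<forall>j\<in>V. (cmp i j \<longleftrightarrow> s i = s j \<or> t i = t j) \<and> (s i = s j \<and> t i = t j \<longrightarrow> i = j)"
  proof (intro ballI)
    fix i j assume ij: "i \<in> V" "j \<in> V"
    show "(cmp i j \<longleftrightarrow> s i = s j \<or> t i = t j) \<and> (s i = s j \<and> t i = t j \<longrightarrow> i = j)"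
      using prod[OF ij] st[OF ij(1)] st[OF ij(2)] antisym[OF ij]
      by (auto simp: dbl_gram_def of_bool_def split: if_splits)
  qed
  show ?thesis by (rule exI[of _ s], rule exI[of _ t], rule *)
qed

text \<open>Distinct comparable \<open>x\<close> and \<open>z\<close> agree in exactly one of
  \<open>s\<close> and \<open>t\<close>. A common neighbour that misses this value would agree with
  both in the other one, forcing \<open>x\<close> and \<open>z\<close> to agree there too; so
  \<open>y\<close> and \<open>w\<close> share it. Against a claw, three neighbours of
  \<open>x\<close> compete for its two ends.\<close>

lemma type_A_diamond_claw_free:
  assumes "pos_semidef n (gram_mat n leq)" and "dyn_is_A n leq m"
  shows diamond_free and claw_free
proof -
  obtain s t :: "nat \<Rightarrow> nat" where *: "\<forall>i\<in>V. \<forall>j\<in>V.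
    (cmp i j \<longleftrightarrow> s i = s j \<or> t i = t j) \<and> (s i = s j \<and> t i = t j \<longrightarrow> i = j)"
    using type_A_line_graph[OF assms] by (elim exE)
  have st1: "cmp i j \<longleftrightarrow> s i = s j \<or> t i = t j" if "i \<in> V" "j \<in> V" for i j
    using *[THEN bspec, OF that(1), THEN bspec, OF that(2)] by (rule conjunct1)
  have st2: "i = j" if "i \<in> V" "j \<in> V" "s i = s j" "t i = t j" for i j
    using *[THEN bspec, OF that(1), THEN bspec, OF that(2)] that(3,4) by simp
  show diamond_free
    unfolding diamond_free_def
  proof (intro ballI impI)
    fix x z y w assume V: "x \<in> V" "z \<in> V" "y \<in> V" "w \<in> V"
      and h: "x \<noteq> z \<and> cmp x z \<and> y \<noteq> x \<and> y \<noteq> z \<and> cmp x y \<and> cmp z y \<and> w \<noteq> x \<and> w \<noteq> z \<and> cmp x w \<and> cmp z w"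
    have "s x = s z \<or> t x = t z" "s x = s y \<or> t x = t y" "s z = s y \<or> t z = t y"
      "s x = s w \<or> t x = t w" "s z = s w \<or> t z = t w"
      using h st1[OF V(1,2)] st1[OF V(1,3)] st1[OF V(2,3)] st1[OF V(1,4)] st1[OF V(2,4)] by simp_all
    moreover have "\<not> (s x = s z \<and> t x = t z)" using h st2[OF V(1,2)] by blast
    ultimately have "s y = s w \<or> t y = t w" by metis
    then show "cmp y w" using st1[OF V(3,4)] by simp
  qed
  show claw_free
    unfolding claw_free_def
  proof (intro ballI impI)
    fix x y z w assume V: "x \<in> V" "y \<in> V" "z \<in> V" "w \<in> V"
      and h: "x \<noteq> y \<and> x \<noteq> z \<and> x \<noteq> w \<and> cmp x y \<and> cmp x z \<and> cmp x w"
    have "s x = s y \<or> t x = t y" "s x = s z \<or> t x = t z" "s x = s w \<or> t x = t w"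
      using h st1[OF V(1,2)] st1[OF V(1,3)] st1[OF V(1,4)] by simp_all
    then have "(s y = s z \<or> t y = t z) \<or> (s y = s w \<or> t y = t w) \<or> (s z = s w \<or> t z = t w)" by metis
    then show "cmp y z \<or> cmp y w \<or> cmp z w"
      using st1[OF V(2,3)] st1[OF V(2,4)] st1[OF V(3,4)] by simp
  qed
qed

lemma hasse_cycle_iff_2_regular:
  assumes conn: "poset_connected n leq"
  shows "hasse_cycle n leq \<longleftrightarrow> hasse_2_regular n leq"
proof
  assume "hasse_cycle n leq"
  then interpret hasse_cycle n leq .
  show "hasse_2_regular n leq"
    unfolding hasse_2_regular_def
  proof
    fix x assume x: "x \<in> V"
    obtain a b where ab: "a \<noteq> b" "adj x a" "adj x b" using two[OF x] by blast
    have "{j \<in> V. adj x j} = {a, b}" using ab deg[of x a b] adjD(2) by blast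
    then show "card {j \<in> V. adj x j} = 2" using ab by simp
  qed
next
  assume r: "hasse_2_regular n leq"
  have nb: "\<exists>a b. a \<noteq> b \<and> {j \<in> V. adj x j} = {a, b}" if "x \<in> V" for x
    using r that unfolding hasse_2_regular_def by (metis card_2_iff)
  show "hasse_cycle n leq"
  proof
    fix x a b c assume h: "adj x a" "adj x b" "adj x c"
    obtain p q where "{j \<in> V. adj x j} = {p, q}" using nb[OF adjD(1)[OF h(1)]] by blast
    moreover have "{a, b, c} \<subseteq> {j \<in> V. adj x j}" using h adjD(2) by blast
    ultimately have "{a, b, c} \<subseteq> {p, q}" by simp
    then show "a = b \<or> a = c \<or> b = c" by auto
  next
    fix x assume x: "x \<in> V"
    obtain a b where ab: "a \<noteq> b" "{j \<in> V. adj x j} = {a, b}" using nb[OF x] by blast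
    have "a \<in> {j \<in> V. adj x j}" "b \<in> {j \<in> V. adj x j}" unfolding ab(2) by simp_all
    then show "\<exists>a b. a \<noteq> b \<and> adj x a \<and> adj x b" using ab(1) by blast
  next
    fix x y assume "x \<in> V" "y \<in> V"
    then show "adj\<^sup>*\<^sup>* x y" using conn unfolding poset_connected_def by blast
  qed
qed

text \<open>With \<open>m\<close> arbitrary, the shape is known before the corank, which can then be
  computed from the shape.\<close>

lemma type_A_path_or_cycle:
  assumes n: "1 \<le> n" and con: "poset_connected n leq"
    and A: "pos_semidef n (gram_mat n leq)" "dyn_is_A n leq m"
  shows "hasse_oriented_path n leq \<or> (hasse_2_regular n leq \<and> 2 \<le> card sinks)"
proof -
  note d = type_A_diamond_claw_free[OF A]
  note deg = hasse_degree_le_2[OF d]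
  have c: "adj\<^sup>*\<^sup>* x y" if "x \<in> V" "y \<in> V" for x y
    using con that unfolding poset_connected_def by blast
  interpret degree_le_2_graph V adj
  proof
    show "finite V" by simp
    show "V \<noteq> {}" using n by simp
    show "y \<in> V" if "adj x y" for x y using adjD(2)[OF that] .
    show "adj y x" if "adj x y" for x y using adj_sym[OF that] .
    show "\<not> adj x x" for x using adjD(4) by blast
    show "a = b \<or> a = c \<or> b = c" if "adj x a" "adj x b" "adj x c" for x a b c using deg[OF that] .
    show "adj\<^sup>*\<^sup>* x y" if "x \<in> V" "y \<in> V" for x y using c[OF that] .
  qed
  from path_or_cycle show ?thesis
  proof
    assume "\<exists>xs. distinct xs \<and> set xs = V \<and>
      (\<forall>a<length xs. \<forall>b<length xs. adj (xs ! a) (xs ! b) \<longleftrightarrow> a + 1 = b \<or> b + 1 = a)"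
    then obtain xs where xs: "distinct xs" "set xs = V"
      "\<forall>a<length xs. \<forall>b<length xs. adj (xs ! a) (xs ! b) \<longleftrightarrow> a + 1 = b \<or> b + 1 = a" by blast
    have "length xs = n" using distinct_card[OF xs(1)] xs(2) by simp
    moreover from this have "bij_betw ((!) xs) {0..<n} V" using xs by (intro bij_betw_nth) auto
    ultimately have "hasse_oriented_path n leq"
      unfolding hasse_oriented_path_def using xs(3) by blast
    then show ?thesis ..
  next
    assume two: "\<forall>x\<in>V. \<exists>a b. a \<noteq> b \<and> adj x a \<and> adj x b"
    have "hasse_cycle n leq"
      by unfold_locales (use deg two c in blast)+
    then show ?thesis using hasse_cycle_iff_2_regular[OF con] two_sinks[OF d(1) n] two by blast
  qed
qed

end

theorem theorem1p2:
  fixes n :: nat and leq :: "nat \<Rightarrow> nat \<Rightarrow> bool"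
  assumes "1 \<le> n" and "is_poset n leq" and "poset_connected n leq"
  shows "((nonneg_crk n leq 0 \<and> dyn_is_A n leq n) \<longleftrightarrow> hasse_oriented_path n leq)
       \<and> ((nonneg_crk n leq 1 \<and> dyn_is_A n leq (n - 1)) \<longleftrightarrow>
            (hasse_2_regular n leq \<and> 2 \<le> card (hasse_sinks n leq)))
       \<and> (\<forall>r. nonneg_crk n leq r \<and> dyn_is_A n leq (n - r) \<longrightarrow> r \<le> 1)"
proof -
  interpret fin_poset n leq using assms(2) by unfold_locales
  have path: "nonneg_crk n leq 0 \<and> dyn_is_A n leq n" if "hasse_oriented_path n leq"
    using oriented_path_type_A[OF assms(2) that] .
  have cycle: "nonneg_crk n leq 1 \<and> dyn_is_A n leq (n - 1)" if "hasse_2_regular n leq" "2 \<le> card sinks"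
    using hasse_cycle.cycle_type_A hasse_cycle_iff_2_regular[OF assms(3)] that by blast
  have shape: "hasse_oriented_path n leq \<or> (hasse_2_regular n leq \<and> 2 \<le> card sinks)"
    if "nonneg_crk n leq r" "dyn_is_A n leq m" for r m
    using type_A_path_or_cycle[OF assms(1,3) _ that(2)] that(1) unfolding nonneg_crk_def by blast
  \<comment> \<open>The bound \<open>r \<le> n\<close> makes the truncated difference
    \<open>n - r\<close> injective in \<open>r\<close>.\<close>
  have uniq: "r = r'" if "nonneg_crk n leq r" "nonneg_crk n leq r'" for r r'
    using that unfolding nonneg_crk_def by linarith
  \<comment> \<open>The wrong shape is excluded by its corank: \<open>path\<close> forces 0 and
    \<open>cycle\<close> forces 1.\<close>
  show ?thesis
  proof (intro conjI iffI allI impI)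
    assume "nonneg_crk n leq 0 \<and> dyn_is_A n leq n"
    then show "hasse_oriented_path n leq" using shape cycle uniq[of 0 1] by auto
  next
    assume "nonneg_crk n leq 1 \<and> dyn_is_A n leq (n - 1)"
    then have "hasse_2_regular n leq \<and> 2 \<le> card sinks" using shape path uniq[of 0 1] by auto
    then show "hasse_2_regular n leq" "2 \<le> card sinks" by auto
  next
    fix r assume h: "nonneg_crk n leq r \<and> dyn_is_A n leq (n - r)"
    then have "nonneg_crk n leq 0 \<or> nonneg_crk n leq 1" using shape path cycle by blast
    then show "r \<le> 1" using uniq[of r 0] uniq[of r 1] h by auto
  qed (use path cycle in blast)+
qed

end
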